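(* For $1\le k\le n$ the odd symplectic group $\mathrm{Sp}_{2n+1}$ acts on the odd symplectic grassmannian $G_\omega(k,2n+1)$ with two orbits $$X_0=\{V\in G_\omega(k,2n+1)\mid e_0\in V\},\qquad X_1=\{V\in G_\omega(k,2n+1)\mid e_0\notin V\}.$$ The closed orbit $X_0$ is isomorphic to the symplectic grassmannian $G_\omega(k-1,2n)$, and the open orbit $X_1$ is isomorphic to the total space of the dual of the tautological bundle on the symplectic grassmannian $G_\omega(k,2n)$.
   Context: $E$ is a complex vector space of dimension $2n+1$ with a skew-form $\omega\in\Lambda^2E^*$ of maximal rank $2n$, and $e_0$ is a generator of the one-dimensional kernel of $\omega$. The odd symplectic group $\mathrm{Sp}_{2n+1}$ is the stabilizer of $\omega$ in $\mathrm{GL}(E)$. $G_\omega(k,2n+1)$ is the variety of $k$-dimensional subspaces of $E$ isotropic for $\omega$ (i.e. on which $\omega$ vanishes). $G_\omega(k,2n)$ is the variety of $k$-dimensional isotropic subspaces of a $2n$-dimensional complex symplectic vector space; its tautological bundle is the rank $k$ bundle whose fiber at $V$ is $V$. *)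

theory Defs
  imports
    "HOL-Analysis.Analysis"
    "HOL-Algebra.Group_Action"
    "HOL-Library.Function_Algebras"
begin

section \<open>Varieties given by an atlas\<close>

text \<open>
  A complex (pre)variety is presented by charts. A chart is a pair \<open>(D, L)\<close> of a subset \<open>D\<close> and
  a set \<open>L\<close> of complex-valued functions; it stands for the domain \<open>D\<close>, identified with a locally
  closed subset of an affine space by the coordinate functions in \<open>L\<close>. Only the values of these
  functions on \<open>D\<close> matter. In all atlases below the intersection of two charts is a basic open
  set of each, and the coordinates of one chart are regular in those of the other.
\<close>

type_synonym 'a atlas = "('a set \<times> ('a \<Rightarrow> complex) set) set"

inductive_set polys :: "('a \<Rightarrow> complex) set \<Rightarrow> ('a \<Rightarrow> complex) set"
  for L :: "('a \<Rightarrow> complex) set" where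
  const: "(\<lambda>_. c) \<in> polys L"
| coord: "p \<in> L \<Longrightarrow> p \<in> polys L"
| add: "p \<in> polys L \<Longrightarrow> q \<in> polys L \<Longrightarrow> (\<lambda>x. p x + q x) \<in> polys L"
| mult: "p \<in> polys L \<Longrightarrow> q \<in> polys L \<Longrightarrow> (\<lambda>x. p x * q x) \<in> polys L"

definition zariski :: "'a atlas \<Rightarrow> 'a topology" where
  "zariski A = topology_generated_by {{x \<in> D. q x \<noteq> 0} | D L q. (D, L) \<in> A \<and> q \<in> polys L}"

text \<open>Regular functions are those which locally, in some chart around every point, are quotients of
  polynomials in the coordinates.\<close>

definition regular_on :: "'a atlas \<Rightarrow> 'a set \<Rightarrow> ('a \<Rightarrow> complex) \<Rightarrow> bool" where
  "regular_on A W f \<longleftrightarrow>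
     (\<forall>x\<in>W. \<exists>D L p q. (D, L) \<in> A \<and> x \<in> D \<and> p \<in> polys L \<and> q \<in> polys L \<and> q x \<noteq> 0 \<and>
        (\<forall>y \<in> W \<inter> D. q y \<noteq> 0 \<longrightarrow> f y = p y / q y))"

definition variety_morphism :: "'a atlas \<Rightarrow> 'b atlas \<Rightarrow> ('a \<Rightarrow> 'b) \<Rightarrow> bool" where
  "variety_morphism A B f \<longleftrightarrow>
     continuous_map (zariski A) (zariski B) f \<and>
     (\<forall>W h. openin (zariski B) W \<longrightarrow> regular_on B W h \<longrightarrow>
        regular_on A {x \<in> topspace (zariski A). f x \<in> W} (h \<circ> f))"

definition variety_isomorphic :: "'a atlas \<Rightarrow> 'b atlas \<Rightarrow> bool" where
  "variety_isomorphic A B \<longleftrightarrow>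
     (\<exists>f g. variety_morphism A B f \<and> variety_morphism B A g \<and>
        (\<forall>x \<in> topspace (zariski A). g (f x) = x) \<and>
        (\<forall>y \<in> topspace (zariski B). f (g y) = y))"

text \<open>The reduced induced structure on a locally closed subset \<open>Y\<close>.\<close>

definition subvariety :: "'a atlas \<Rightarrow> 'a set \<Rightarrow> 'a atlas" where
  "subvariety A Y = {(D \<inter> Y, L) | D L. (D, L) \<in> A}"


section \<open>Skew-forms\<close>

text \<open>Complex vector spaces are types with an explicit scalar multiplication \<open>s\<close>.\<close>

abbreviation functional :: "(complex \<Rightarrow> 'v::ab_group_add \<Rightarrow> 'v) \<Rightarrow> ('v \<Rightarrow> complex) \<Rightarrow> bool" where
  "functional s \<equiv> Vector_Spaces.linear s (*)"

definition skew_form ::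
    "(complex \<Rightarrow> 'v::ab_group_add \<Rightarrow> 'v) \<Rightarrow> ('v \<Rightarrow> 'v \<Rightarrow> complex) \<Rightarrow> bool" where
  "skew_form s \<omega> \<longleftrightarrow>
     (\<forall>x. functional s (\<omega> x)) \<and> (\<forall>y. functional s (\<lambda>x. \<omega> x y)) \<and> (\<forall>x y. \<omega> x y = - \<omega> y x)"

text \<open>The rank of \<open>\<omega>\<close> is the rank of the linear map \<open>x \<mapsto> \<omega>(x, \<cdot>)\<close> into the dual space.\<close>

definition form_rank :: "('v \<Rightarrow> 'v \<Rightarrow> complex) \<Rightarrow> nat" where
  "form_rank \<omega> = vector_space.dim (\<lambda>c (f :: 'v \<Rightarrow> complex) x. c * f x) (range \<omega>)"

definition form_kernel :: "('v \<Rightarrow> 'v \<Rightarrow> complex) \<Rightarrow> 'v set" where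
  "form_kernel \<omega> = {x. \<forall>y. \<omega> x y = 0}"

definition odd_symplectic_space ::
    "nat \<Rightarrow> (complex \<Rightarrow> 'v::ab_group_add \<Rightarrow> 'v) \<Rightarrow> ('v \<Rightarrow> 'v \<Rightarrow> complex) \<Rightarrow> bool" where
  "odd_symplectic_space n s \<omega> \<longleftrightarrow>
     vector_space s \<and> vector_space.dim s UNIV = 2 * n + 1 \<and> skew_form s \<omega> \<and> form_rank \<omega> = 2 * n"

definition symplectic_space ::
    "nat \<Rightarrow> (complex \<Rightarrow> 'v::ab_group_add \<Rightarrow> 'v) \<Rightarrow> ('v \<Rightarrow> 'v \<Rightarrow> complex) \<Rightarrow> bool" where
  "symplectic_space n s \<omega> \<longleftrightarrow>
     vector_space s \<and> vector_space.dim s UNIV = 2 * n \<and> skew_form s \<omega> \<and> form_kernel \<omega> = {0}"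

definition GL :: "(complex \<Rightarrow> 'v::ab_group_add \<Rightarrow> 'v) \<Rightarrow> ('v \<Rightarrow> 'v) monoid" where
  "GL s = \<lparr>carrier = {g. Vector_Spaces.linear s s g \<and> bij g}, mult = (\<circ>), one = id\<rparr>"

definition Sp ::
    "(complex \<Rightarrow> 'v::ab_group_add \<Rightarrow> 'v) \<Rightarrow> ('v \<Rightarrow> 'v \<Rightarrow> complex) \<Rightarrow> ('v \<Rightarrow> 'v) monoid" where
  "Sp s \<omega> = (GL s)\<lparr>carrier := {g \<in> carrier (GL s). \<forall>x y. \<omega> (g x) (g y) = \<omega> x y}\<rparr>"


section \<open>Grassmannians\<close>

definition grass :: "(complex \<Rightarrow> 'v::ab_group_add \<Rightarrow> 'v) \<Rightarrow> nat \<Rightarrow> 'v set set" where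
  "grass s k = {V. module.subspace s V \<and> vector_space.dim s V = k}"

text \<open>
  The standard affine charts: linear functionals \<open>l 0, \<dots>, l (k-1)\<close> determine the chart
  of all \<open>V\<close> on which they restrict to linear coordinates, i.e. of all complements of their
  common kernel (if the \<open>l i\<close> are linearly dependent, this chart is empty). Such a \<open>V\<close> has a
  unique basis dual to the \<open>l i\<close>, and the entries of these basis vectors are the
  affine coordinates of \<open>V\<close>.
\<close>

definition grass_chart ::
    "(complex \<Rightarrow> 'v::ab_group_add \<Rightarrow> 'v) \<Rightarrow> nat \<Rightarrow> (nat \<Rightarrow> 'v \<Rightarrow> complex) \<Rightarrow> 'v set set" where
  "grass_chart s k l = {V \<in> grass s k. \<forall>v\<in>V. (\<forall>i<k. l i v = 0) \<longrightarrow> v = 0}"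

definition chart_frame :: "nat \<Rightarrow> (nat \<Rightarrow> 'v \<Rightarrow> complex) \<Rightarrow> 'v set \<Rightarrow> nat \<Rightarrow> 'v" where
  "chart_frame k l V j = (THE v. v \<in> V \<and> (\<forall>i<k. l i v = (if i = j then 1 else 0)))"

definition grass_variety :: "(complex \<Rightarrow> 'v::ab_group_add \<Rightarrow> 'v) \<Rightarrow> nat \<Rightarrow> 'v set atlas" where
  "grass_variety s k =
     {(grass_chart s k l, {\<lambda>V. m (chart_frame k l V j) | m j. functional s m \<and> j < k}) | l.
        \<forall>i<k. functional s (l i)}"

definition isotropic_grass ::
    "(complex \<Rightarrow> 'v::ab_group_add \<Rightarrow> 'v) \<Rightarrow> ('v \<Rightarrow> 'v \<Rightarrow> complex) \<Rightarrow> nat \<Rightarrow> 'v set set" where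
  "isotropic_grass s \<omega> k = {V \<in> grass s k. \<forall>x\<in>V. \<forall>y\<in>V. \<omega> x y = 0}"

definition isotropic_grass_variety ::
    "(complex \<Rightarrow> 'v::ab_group_add \<Rightarrow> 'v) \<Rightarrow> ('v \<Rightarrow> 'v \<Rightarrow> complex) \<Rightarrow> nat \<Rightarrow> 'v set atlas" where
  "isotropic_grass_variety s \<omega> k = subvariety (grass_variety s k) (isotropic_grass s \<omega> k)"

definition subspace_action ::
    "(complex \<Rightarrow> 'v::ab_group_add \<Rightarrow> 'v) \<Rightarrow> ('v \<Rightarrow> 'v \<Rightarrow> complex) \<Rightarrow> nat \<Rightarrow>
     ('v \<Rightarrow> 'v) \<Rightarrow> 'v set \<Rightarrow> 'v set" where
  "subspace_action s \<omega> k = (\<lambda>g. \<lambda>V \<in> isotropic_grass s \<omega> k. g ` V)"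


section \<open>The dual of the tautological bundle\<close>

definition dual_space :: "(complex \<Rightarrow> 'v::ab_group_add \<Rightarrow> 'v) \<Rightarrow> 'v set \<Rightarrow> ('v \<Rightarrow> complex) set" where
  "dual_space s V = {\<phi> \<in> extensional V.
     (\<forall>x\<in>V. \<forall>y\<in>V. \<phi> (x + y) = \<phi> x + \<phi> y) \<and> (\<forall>c. \<forall>x\<in>V. \<phi> (s c x) = c * \<phi> x)}"

text \<open>
  Over a chart of the Grassmannian, the vectors \<open>chart_frame k l V j\<close> for \<open>j < k\<close> form an algebraic
  frame of the tautological bundle. It trivialises the dual bundle by
  \<open>\<phi> \<mapsto> (\<phi> (chart_frame k l V j))\<^sub>j\<close>, and the chart of the total space is the product of the
  chart of the base with affine \<open>k\<close>-space.
\<close>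

definition dual_taut_variety ::
    "(complex \<Rightarrow> 'v::ab_group_add \<Rightarrow> 'v) \<Rightarrow> ('v \<Rightarrow> 'v \<Rightarrow> complex) \<Rightarrow> nat \<Rightarrow>
     ('v set \<times> ('v \<Rightarrow> complex)) atlas" where
  "dual_taut_variety s \<omega> k =
     {(SIGMA V : D. dual_space s V,
       {\<lambda>(V, \<phi>). p V | p. p \<in> L} \<union> {\<lambda>(V, \<phi>). \<phi> (chart_frame k l V j) | j. j < k}) | D L l.
        (\<forall>i<k. functional s (l i)) \<and>
        D = grass_chart s k l \<inter> isotropic_grass s \<omega> k \<and>
        L = {\<lambda>V. m (chart_frame k l V j) | m j. functional s m \<and> j < k}}"

end

theory Submission
  imports Defs
begin

text \<open>
  The form \<open>\<omega>\<close> only sees the quotient of \<open>E\<close> by its kernel. There are a linear surjection \<open>\<pi>\<close> from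
  \<open>E\<close> onto \<open>F\<close> whose kernel is the line of \<open>e0\<close> and which satisfies \<open>\<omega> x y = \<sigma> (\<pi> x) (\<pi> y)\<close>, a linear
  section \<open>\<iota>\<close> of \<open>\<pi>\<close>, and a functional \<open>\<eta>\<close> with \<open>\<eta> e0 = 1\<close> that vanishes on the image of \<open>\<iota>\<close>
  (\<open>odd_splitting_exists\<close>). Thus \<open>V\<close> is isotropic if and only if \<open>\<pi> ` V\<close> is.

  If \<open>e0 \<in> V\<close>, then \<open>V\<close> is the preimage of \<open>\<pi> ` V\<close>, whose dimension is smaller by one; this
  identifies \<open>X0\<close> with the Grassmannian of isotropic \<open>(k-1)\<close>-spaces in \<open>F\<close>. If \<open>e0 \<notin> V\<close>, then \<open>\<pi>\<close> is
  injective on \<open>V\<close>, and \<open>V\<close> is the graph of a functional on \<open>U = \<pi> ` V\<close>, namely of \<open>\<eta>\<close> in terms of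
  \<open>\<pi>\<close>. Every functional on every isotropic \<open>U\<close> occurs, so \<open>X1\<close> is the total space of the dual
  tautological bundle.

  That these bijections are morphisms in both directions is a question about charts
  (\<open>variety_morphismI\<close>). A point \<open>V\<close> of the chart of functionals \<open>l\<close> is recorded by its frame dual to
  \<open>l\<close>, so one has to write the frame of the image in terms of the frame of the argument. In three of
  the four directions each chart of the target has a matching chart of the source for which this
  expression is polynomial: functionals on \<open>F\<close> are pulled back along \<open>\<pi>\<close>, and functionals on \<open>E\<close> are made
  to vanish at \<open>e0\<close> by an elimination step. From pairs \<open>(U, \<phi>)\<close> to graphs a matrix that depends on
  \<open>\<phi>\<close> has to be inverted; for a chart of \<open>F\<close> adapted to the given point this matrix is a rank one
  perturbation of the identity, and the Sherman-Morrison formula supplies the rational expression.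

  Elements of the group preserve the kernel of \<open>\<omega>\<close>, so an orbit lies in \<open>X0\<close> or in \<open>X1\<close>. Conversely,
  Witt's theorem in \<open>F\<close> (\<open>witt_isometry\<close>) moves \<open>\<pi> ` V\<close> to \<open>\<pi> ` V'\<close>; the isometry lifts to \<open>E\<close>, and
  adding to the lift a functional of \<open>\<pi>\<close> times \<open>e0\<close> matches the slopes of the two graphs. Both Witt's
  theorem and the splitting come from hyperbolic systems of vectors: a symplectic basis expresses the
  coordinates of a vector by the form itself, so a linear isometry between two spaces can be written
  down from two such bases (\<open>transfer\<close>).
\<close>

section \<open>Morphisms in charts\<close>

lemma topspace_zariski: "topspace (zariski A) = \<Union> (fst ` A)"
proof -
  let ?B = "{{x \<in> D. q x \<noteq> 0} | D L q. (D, L) \<in> A \<and> q \<in> polys L}"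
  have "fst C \<subseteq> \<Union> ?B" if "C \<in> A" for C
  proof -
    have "fst C = {x \<in> fst C. (\<lambda>_. 1 :: complex) x \<noteq> 0}"
      by simp
    with that polys.const[of 1 "snd C"] have "fst C \<in> ?B"
      by (intro CollectI exI[of _ "fst C"] exI[of _ "snd C"] exI[of _ "\<lambda>_. 1"] conjI) simp_all
    then show ?thesis
      by (rule Union_upper)
  qed
  moreover have "U \<subseteq> \<Union> (fst ` A)" if "U \<in> ?B" for U
  proof -
    from that show ?thesis
    proof (elim CollectE exE conjE)
      fix D L and q :: "'a \<Rightarrow> complex"
      assume "U = {x \<in> D. q x \<noteq> 0}" "(D, L) \<in> A"
      then show "U \<subseteq> \<Union> (fst ` A)"
        by force
    qed
  qed
  ultimately have "\<Union> ?B = \<Union> (fst ` A)"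
    by (intro subset_antisym Union_least UN_least)
  then show ?thesis
    unfolding zariski_def topology_generated_by_topspace .
qed

lemma topspace_zariski_family:
  "topspace (zariski {(F l, G l) | l. P l}) = (\<Union>l\<in>Collect P. F l)"
  by (simp add: topspace_zariski setcompr_eq_image image_image)

lemma openin_zariski_basic:
  assumes "(D, L) \<in> A" "q \<in> polys L"
  shows "openin (zariski A) {x \<in> D. q x \<noteq> 0}"
  unfolding zariski_def by (rule topology_generated_by_Basis) (use assms in blast)

lemma openin_zariski_chart: "(D, L) \<in> A \<Longrightarrow> openin (zariski A) D"
  using openin_zariski_basic[OF _ polys.const[of 1]] by simp

lemma polys_sum:
  assumes "\<And>i. i \<in> I \<Longrightarrow> f i \<in> polys L"
  shows "(\<lambda>x. \<Sum>i\<in>I. f i x) \<in> polys L"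
  using assms
  by (induction I rule: infinite_finite_induct) (auto intro: polys.const polys.add)

lemma polys_scale: "p \<in> polys L \<Longrightarrow> (\<lambda>x. c * p x) \<in> polys L"
  by (rule polys.mult[OF polys.const])

lemma polys_diff:
  assumes "p \<in> polys L" "q \<in> polys L"
  shows "(\<lambda>x. p x - q x) \<in> polys L"
  using polys.add[OF assms(1) polys_scale[OF assms(2), of "-1"]] by simp

text \<open>
  Fractions with denominators that do not vanish are closed under sums and products, so a rational
  expression for the pullbacks of the coordinates gives one for the pullback of every polynomial.
\<close>

lemma polys_pullback_rational:
  assumes coords: "\<forall>p\<in>L'. \<exists>r\<in>polys L. \<forall>y\<in>D. q y \<noteq> 0 \<longrightarrow> p (f y) = r y / q y"
    and q: "q \<in> polys L" and p: "p \<in> polys L'"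
  shows "\<exists>r\<in>polys L. \<exists>t\<in>polys L. \<forall>y\<in>D. q y \<noteq> 0 \<longrightarrow> t y \<noteq> 0 \<and> p (f y) = r y / t y"
  using p
proof (induction p)
  case (const c)
  show ?case
    by (rule bexI[OF _ polys.const[of c]], rule bexI[OF _ polys.const[of 1]]) simp
next
  case (coord p)
  then show ?case
    using coords q by blast
next
  case (add p p')
  obtain r t where rt: "r \<in> polys L" "t \<in> polys L"
    and p: "\<And>y. y \<in> D \<Longrightarrow> q y \<noteq> 0 \<Longrightarrow> t y \<noteq> 0 \<and> p (f y) = r y / t y"
    using add.IH(1) by blast
  obtain r' t' where rt': "r' \<in> polys L" "t' \<in> polys L"
    and p': "\<And>y. y \<in> D \<Longrightarrow> q y \<noteq> 0 \<Longrightarrow> t' y \<noteq> 0 \<and> p' (f y) = r' y / t' y"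
    using add.IH(2) by blast
  have "\<forall>y\<in>D. q y \<noteq> 0 \<longrightarrow> t y * t' y \<noteq> 0 \<and> p (f y) + p' (f y) = (r y * t' y + r' y * t y) / (t y * t' y)"
    using p p' by (simp add: field_simps)
  then show ?case
    by (intro bexI[where x = "\<lambda>y. r y * t' y + r' y * t y"] bexI[where x = "\<lambda>y. t y * t' y"]
      polys.add[OF polys.mult[OF rt(1) rt'(2)] polys.mult[OF rt'(1) rt(2)]] polys.mult[OF rt(2) rt'(2)])
next
  case (mult p p')
  obtain r t where rt: "r \<in> polys L" "t \<in> polys L"
    and p: "\<And>y. y \<in> D \<Longrightarrow> q y \<noteq> 0 \<Longrightarrow> t y \<noteq> 0 \<and> p (f y) = r y / t y"
    using mult.IH(1) by blast
  obtain r' t' where rt': "r' \<in> polys L" "t' \<in> polys L"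
    and p': "\<And>y. y \<in> D \<Longrightarrow> q y \<noteq> 0 \<Longrightarrow> t' y \<noteq> 0 \<and> p' (f y) = r' y / t' y"
    using mult.IH(2) by blast
  have "\<forall>y\<in>D. q y \<noteq> 0 \<longrightarrow> t y * t' y \<noteq> 0 \<and> p (f y) * p' (f y) = (r y * r' y) / (t y * t' y)"
    using p p' by (simp add: field_simps)
  then show ?case
    by (intro bexI[where x = "\<lambda>y. r y * r' y"] bexI[where x = "\<lambda>y. t y * t' y"]
      polys.mult[OF rt(1) rt'(1)] polys.mult[OF rt(2) rt'(2)])
qed

text \<open>
  Continuity and the pullback of regular functions are both local in the source. Around each point it
  therefore suffices to have, for each chart of the target through its image, one chart of the source in
  which the pulled back coordinates are fractions with a common denominator \<open>q\<close>. The target condition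
  ranges over all charts because the basic open sets of every chart generate the topology.
\<close>

lemma variety_morphismI:
  assumes maps: "\<And>x. x \<in> topspace (zariski A) \<Longrightarrow> f x \<in> topspace (zariski B)"
    and local: "\<And>D' L' x. (D', L') \<in> B \<Longrightarrow> x \<in> topspace (zariski A) \<Longrightarrow> f x \<in> D' \<Longrightarrow>
      \<exists>D L q. (D, L) \<in> A \<and> x \<in> D \<and> q \<in> polys L \<and> q x \<noteq> 0 \<and> (\<forall>y\<in>D. q y \<noteq> 0 \<longrightarrow> f y \<in> D') \<and>
        (\<forall>p\<in>L'. \<exists>r\<in>polys L. \<forall>y\<in>D. q y \<noteq> 0 \<longrightarrow> p (f y) = r y / q y)"
  shows "variety_morphism A B f"
  unfolding variety_morphism_def
proof (intro conjI allI impI)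
  show "continuous_map (zariski A) (zariski B) f"
    unfolding zariski_def[of B]
  proof (rule continuous_on_generated_topo)
    show "f ` topspace (zariski A) \<subseteq> \<Union> {{x \<in> D. q x \<noteq> 0} |D L q. (D, L) \<in> B \<and> q \<in> polys L}"
      using maps unfolding zariski_def[of B] topology_generated_by_topspace by blast
    fix U assume "U \<in> {{x \<in> D. q x \<noteq> 0} |D L q. (D, L) \<in> B \<and> q \<in> polys L}"
    then obtain D' L' q' where U: "U = {x \<in> D'. q' x \<noteq> 0}" and B: "(D', L') \<in> B" "q' \<in> polys L'"
      by blast
    show "openin (zariski A) (f -` U \<inter> topspace (zariski A))"
    proof (subst openin_subopen, intro ballI)
      fix x assume "x \<in> f -` U \<inter> topspace (zariski A)"
      then have x: "x \<in> topspace (zariski A)" "f x \<in> D'" "q' (f x) \<noteq> 0"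
        by (auto simp: U)
      obtain D L q where D: "(D, L) \<in> A" "x \<in> D" "q \<in> polys L" "q x \<noteq> 0"
        "\<forall>y\<in>D. q y \<noteq> 0 \<longrightarrow> f y \<in> D'"
        "\<forall>p\<in>L'. \<exists>r\<in>polys L. \<forall>y\<in>D. q y \<noteq> 0 \<longrightarrow> p (f y) = r y / q y"
        using local[OF B(1) x(1,2)] by blast
      obtain r t where rt: "r \<in> polys L" "t \<in> polys L"
        "\<forall>y\<in>D. q y \<noteq> 0 \<longrightarrow> t y \<noteq> 0 \<and> q' (f y) = r y / t y"
        using polys_pullback_rational[OF D(6) D(3) B(2)] by blast
      let ?N = "{y \<in> D. q y * r y \<noteq> 0}"
      have "openin (zariski A) ?N"
        by (rule openin_zariski_basic[OF D(1) polys.mult[OF D(3) rt(1)]])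
      moreover have "x \<in> ?N"
        using D x rt by auto
      moreover have "?N \<subseteq> f -` U \<inter> topspace (zariski A)"
        using D rt by (auto simp: U topspace_zariski intro!: rev_bexI[of "(D, L)"])
      ultimately show "\<exists>T. openin (zariski A) T \<and> x \<in> T \<and> T \<subseteq> f -` U \<inter> topspace (zariski A)"
        by blast
    qed
  qed
next
  fix W h
  assume W: "openin (zariski B) W" and h: "regular_on B W h"
  show "regular_on A {x \<in> topspace (zariski A). f x \<in> W} (h \<circ> f)"
    unfolding regular_on_def
  proof
    fix x assume "x \<in> {x \<in> topspace (zariski A). f x \<in> W}"
    then have x: "x \<in> topspace (zariski A)" "f x \<in> W"
      by auto
    obtain D' L' p' q' where B: "(D', L') \<in> B" "f x \<in> D'" "p' \<in> polys L'" "q' \<in> polys L'"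
      "q' (f x) \<noteq> 0" "\<forall>z \<in> W \<inter> D'. q' z \<noteq> 0 \<longrightarrow> h z = p' z / q' z"
      using h x(2) unfolding regular_on_def by blast
    obtain D L q where D: "(D, L) \<in> A" "x \<in> D" "q \<in> polys L" "q x \<noteq> 0"
      "\<forall>y\<in>D. q y \<noteq> 0 \<longrightarrow> f y \<in> D'"
      "\<forall>p\<in>L'. \<exists>r\<in>polys L. \<forall>y\<in>D. q y \<noteq> 0 \<longrightarrow> p (f y) = r y / q y"
      using local[OF B(1) x(1) B(2)] by blast
    obtain r t where rt: "r \<in> polys L" "t \<in> polys L"
      "\<forall>y\<in>D. q y \<noteq> 0 \<longrightarrow> t y \<noteq> 0 \<and> p' (f y) = r y / t y"
      using polys_pullback_rational[OF D(6) D(3) B(3)] by blast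
    obtain r' t' where rt': "r' \<in> polys L" "t' \<in> polys L"
      "\<forall>y\<in>D. q y \<noteq> 0 \<longrightarrow> t' y \<noteq> 0 \<and> q' (f y) = r' y / t' y"
      using polys_pullback_rational[OF D(6) D(3) B(4)] by blast
    show "\<exists>D L p q. (D, L) \<in> A \<and> x \<in> D \<and> p \<in> polys L \<and> q \<in> polys L \<and> q x \<noteq> 0 \<and>
        (\<forall>y \<in> {x \<in> topspace (zariski A). f x \<in> W} \<inter> D. q y \<noteq> 0 \<longrightarrow> (h \<circ> f) y = p y / q y)"
    proof (intro exI conjI)
      show "(\<lambda>y. q y * (r y * t' y)) \<in> polys L" "(\<lambda>y. q y * (t y * r' y)) \<in> polys L"
        by (intro polys.mult D(3) rt(1,2) rt'(1,2))+
      show "(D, L) \<in> A" "x \<in> D"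
        using D by auto
      show "q x * (t x * r' x) \<noteq> 0"
        using D(2,4) rt(3) rt'(3) B(5) by fastforce
      show "\<forall>y \<in> {x \<in> topspace (zariski A). f x \<in> W} \<inter> D. q y * (t y * r' y) \<noteq> 0 \<longrightarrow>
          (h \<circ> f) y = q y * (r y * t' y) / (q y * (t y * r' y))"
      proof (intro ballI impI)
        fix y assume y: "y \<in> {x \<in> topspace (zariski A). f x \<in> W} \<inter> D" "q y * (t y * r' y) \<noteq> 0"
        then have "q' (f y) \<noteq> 0"
          using rt'(3) by auto
        then have "h (f y) = p' (f y) / q' (f y)"
          using B(6) D(5) y by auto
        then show "(h \<circ> f) y = q y * (r y * t' y) / (q y * (t y * r' y))"
          using rt(3) rt'(3) y by (simp add: field_simps)
      qed
    qed
  qed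
qed

lemma variety_morphism_polyI:
  assumes maps: "\<And>x. x \<in> topspace (zariski A) \<Longrightarrow> f x \<in> topspace (zariski B)"
    and local: "\<And>D' L' x. (D', L') \<in> B \<Longrightarrow> x \<in> topspace (zariski A) \<Longrightarrow> f x \<in> D' \<Longrightarrow>
      \<exists>D L. (D, L) \<in> A \<and> x \<in> D \<and> (\<forall>y\<in>D. f y \<in> D') \<and>
        (\<forall>p\<in>L'. \<exists>r\<in>polys L. \<forall>y\<in>D. p (f y) = r y)"
  shows "variety_morphism A B f"
proof (rule variety_morphismI[OF maps])
  fix D' L' x assume B: "(D', L') \<in> B" and x: "x \<in> topspace (zariski A)" and fx: "f x \<in> D'"
  obtain D L where D: "(D, L) \<in> A" "x \<in> D" "\<forall>y\<in>D. f y \<in> D'"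
    and pull: "\<forall>p\<in>L'. \<exists>r\<in>polys L. \<forall>y\<in>D. p (f y) = r y"
    using local[OF B x fx] by (elim exE conjE)
  have "\<forall>p\<in>L'. \<exists>r\<in>polys L. \<forall>y\<in>D. (1::complex) \<noteq> 0 \<longrightarrow> p (f y) = r y / 1"
    using pull by simp
  with D show "\<exists>D L q. (D, L) \<in> A \<and> x \<in> D \<and> q \<in> polys L \<and> q x \<noteq> 0 \<and> (\<forall>y\<in>D. q y \<noteq> 0 \<longrightarrow> f y \<in> D') \<and>
        (\<forall>p\<in>L'. \<exists>r\<in>polys L. \<forall>y\<in>D. q y \<noteq> 0 \<longrightarrow> p (f y) = r y / q y)"
    by (intro exI[of _ D] exI[of _ L] exI[of _ "\<lambda>_. 1"] conjI polys.const) simp_all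
qed

section \<open>Frames in the charts of the Grassmannian\<close>

lemma vector_space_complex: "vector_space ((*) :: complex \<Rightarrow> complex \<Rightarrow> complex)"
  by unfold_locales (auto simp: algebra_simps)

lemma functional_iff:
  "functional s f \<longleftrightarrow> vector_space s \<and> (\<forall>x y. f (x + y) = f x + f y) \<and> (\<forall>c x. f (s c x) = c * f x)"
  using vector_space_complex by (auto simp: Vector_Spaces.linear_iff)

lemma functional_compose: "Vector_Spaces.linear s s' f \<Longrightarrow> functional s' l \<Longrightarrow> functional s (\<lambda>x. l (f x))"
  by (simp add: Vector_Spaces.linear_iff)

locale complex_space = finite_dimensional_vector_space s Basis
  for s :: "complex \<Rightarrow> 'v::ab_group_add \<Rightarrow> 'v" and Basis :: "'v set"
begin

lemma functionalI:
  "(\<And>x y. f (x + y) = f x + f y) \<Longrightarrow> (\<And>c x. f (s c x) = c * f x) \<Longrightarrow> functional s f"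
  using vector_space_axioms by (simp add: functional_iff)

lemma functional_sum_expand:
  assumes "functional s f"
  shows "f (\<Sum>i\<in>I. s (c i) (w i)) = (\<Sum>i\<in>I. c i * f (w i))"
proof -
  have "f (\<Sum>i\<in>I. s (c i) (w i)) = (\<Sum>i\<in>I. f (s (c i) (w i)))"
    using module_hom.sum[OF linear_iff_module_hom[THEN iffD1, OF assms]] .
  then show ?thesis
    using assms by (simp add: functional_iff)
qed

lemma functional_arith:
  assumes "functional s f"
  shows "f (x + y) = f x + f y" "f (x - y) = f x - f y" "f (- x) = - f x" "f 0 = 0" "f (s c x) = c * f x"
  using assms module_hom.diff[OF linear_iff_module_hom[THEN iffD1, OF assms]]
    module_hom.neg[OF linear_iff_module_hom[THEN iffD1, OF assms]]
    module_hom.zero[OF linear_iff_module_hom[THEN iffD1, OF assms]]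
  by (simp_all add: functional_iff)

lemma dual_family_independent:
  fixes k :: nat
  assumes l: "\<And>i. i < k \<Longrightarrow> functional s (l i)"
    and lw: "\<And>i j. i < k \<Longrightarrow> j < k \<Longrightarrow> l i (w j) = (if i = j then 1 else 0)"
  shows "inj_on w {..<k}" "independent (w ` {..<k})"
proof -
  show inj: "inj_on w {..<k}"
  proof (rule inj_onI)
    fix i j assume "i \<in> {..<k}" "j \<in> {..<k}" "w i = w j"
    then show "i = j"
      using lw[of i i] lw[of i j] by (auto split: if_splits)
  qed
  show "independent (w ` {..<k})"
  proof (rule independent_if_scalars_zero)
    fix f x assume 0: "(\<Sum>x\<in>w ` {..<k}. s (f x) x) = 0" and "x \<in> w ` {..<k}"
    then obtain i where i: "i < k" "x = w i"
      by auto
    have "(\<Sum>j<k. s (f (w j)) (w j)) = 0"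
      using 0 by (simp add: sum.reindex[OF inj])
    then have "(\<Sum>j<k. f (w j) * l i (w j)) = 0"
      using functional_sum_expand[OF l[OF i(1)], of "\<lambda>j. f (w j)" w "{..<k}"] functional_arith(4)[OF l[OF i(1)]]
      by simp
    moreover have "(\<Sum>j<k. f (w j) * l i (w j)) = (\<Sum>j<k. if i = j then f (w j) else 0)"
      using i by (intro sum.cong) (auto simp: lw)
    moreover have "\<dots> = f (w i)"
      using i(1) by simp
    ultimately show "f x = 0"
      using i(2) by simp
  qed simp
qed

text \<open>
  A family in \<open>V\<close> that is dual to \<open>k = dim V\<close> functionals is a basis, and the functionals are the
  coordinates with respect to it.
\<close>

lemma dual_family_expand:
  assumes V: "V \<in> grass s k" and l: "\<And>i. i < k \<Longrightarrow> functional s (l i)"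
    and w: "\<And>j. j < k \<Longrightarrow> w j \<in> V"
    and lw: "\<And>i j. i < k \<Longrightarrow> j < k \<Longrightarrow> l i (w j) = (if i = j then 1 else 0)"
    and x: "x \<in> V"
  shows "x = (\<Sum>j<k. s (l j x) (w j))"
proof -
  note ind = dual_family_independent[OF l lw]
  have "V \<subseteq> span (w ` {..<k})"
  proof (rule card_ge_dim_independent)
    show "w ` {..<k} \<subseteq> V"
      using w by auto
    show "dim V \<le> card (w ` {..<k})"
      using V card_image[OF ind(1)] by (simp add: grass_def)
  qed (use ind in auto)
  then have "x \<in> span (w ` {..<k})"
    using x by auto
  then obtain u where "x = (\<Sum>v\<in>w ` {..<k}. s (u v) v)"
    unfolding span_finite[OF finite_imageI[OF finite_lessThan]] by auto
  then have xu: "x = (\<Sum>j<k. s (u (w j)) (w j))"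
    by (simp add: sum.reindex[OF ind(1)])
  have "l i x = u (w i)" if "i < k" for i
  proof -
    have "l i x = (\<Sum>j<k. u (w j) * l i (w j))"
      by (subst xu) (rule functional_sum_expand[OF l[OF that]])
    also have "\<dots> = (\<Sum>j<k. if i = j then u (w j) else 0)"
      using that by (intro sum.cong) (auto simp: lw)
    finally show ?thesis
      using that by simp
  qed
  then show ?thesis
    by (subst xu) simp
qed

lemma grass_chart_dualI:
  assumes "V \<in> grass s k" "\<And>i. i < k \<Longrightarrow> functional s (l i)" "\<And>j. j < k \<Longrightarrow> w j \<in> V"
    "\<And>i j. i < k \<Longrightarrow> j < k \<Longrightarrow> l i (w j) = (if i = j then 1 else 0)"
  shows "V \<in> grass_chart s k l"
  unfolding grass_chart_def
proof (intro CollectI conjI ballI impI)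
  fix v assume "v \<in> V" "\<forall>i<k. l i v = 0"
  then show "v = 0"
    using dual_family_expand[OF assms, of v] by simp
qed (fact assms)

text \<open>
  Here the dimension of \<open>V\<close> is a consequence: every vector of \<open>V\<close> agrees with the combination of the \<open>w j\<close>
  that has the same values under the \<open>l i\<close>.
\<close>

lemma grass_chartI:
  assumes V: "subspace V" and l: "\<And>i. i < k \<Longrightarrow> functional s (l i)"
    and w: "\<And>j. j < k \<Longrightarrow> w j \<in> V"
    and lw: "\<And>i j. i < k \<Longrightarrow> j < k \<Longrightarrow> l i (w j) = (if i = j then 1 else 0)"
    and ker: "\<And>v. v \<in> V \<Longrightarrow> \<forall>i<k. l i v = 0 \<Longrightarrow> v = 0"
  shows "V \<in> grass_chart s k l"
proof -
  note ind = dual_family_independent[OF l lw]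
  have "V \<subseteq> span (w ` {..<k})"
  proof
    fix x assume x: "x \<in> V"
    let ?y = "\<Sum>j<k. s (l j x) (w j)"
    have y: "?y \<in> V"
      using V w by (intro subspace_sum subspace_scale) auto
    have "l i ?y = l i x" if "i < k" for i
    proof -
      have "l i ?y = (\<Sum>j<k. l j x * l i (w j))"
        by (rule functional_sum_expand[OF l[OF that]])
      also have "\<dots> = (\<Sum>j<k. if i = j then l j x else 0)"
        using that by (intro sum.cong) (auto simp: lw)
      finally show ?thesis
        using that by simp
    qed
    then have "x - ?y = 0"
      using V x y by (intro ker) (auto simp: functional_arith(2)[OF l] subspace_diff)
    then have "x = ?y"
      by simp
    also have "\<dots> \<in> span (w ` {..<k})"
      by (intro span_sum span_scale span_base) auto
    finally show "x \<in> span (w ` {..<k})" .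
  qed
  then have "dim V = card (w ` {..<k})"
    using w ind by (intro basis_card_eq_dim[symmetric]) auto
  then have "V \<in> grass s k"
    using V by (simp add: grass_def card_image[OF ind(1)])
  then show ?thesis
    using ker by (simp add: grass_chart_def)
qed

text \<open>
  For a basis \<open>v\<close> of \<open>V\<close> the endomorphism \<open>x \<mapsto> \<Sum>i<k. l i x \<cdot> v i\<close> of \<open>V\<close> is injective by the definition of
  the chart, hence surjective; the preimages of the \<open>v j\<close> form the dual frame.
\<close>

lemma grass_chart_dual_frame:
  assumes V: "V \<in> grass_chart s k l" and l: "\<And>i. i < k \<Longrightarrow> functional s (l i)" and j: "j < k"
  shows "\<exists>w\<in>V. \<forall>i<k. l i w = (if i = j then 1 else 0)"
proof -
  have sub: "subspace V" and dim: "dim V = k" and ker: "\<And>v. v \<in> V \<Longrightarrow> \<forall>i<k. l i v = 0 \<Longrightarrow> v = 0"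
    using V by (auto simp: grass_chart_def grass_def)
  obtain B where B: "B \<subseteq> V" "independent B" "V \<subseteq> span B" "card B = k"
    using basis_exists[of V] dim by metis
  then obtain v where v: "bij_betw v {..<k} B"
    using ex_bij_betw_nat_finite[OF finiteI_independent[OF B(2)]] by (auto simp: atLeast0LessThan)
  \<comment> \<open>The endomorphism that compares the functionals with the basis.\<close>
  define a where "a x = (\<Sum>i<k. s (l i x) (v i))" for x
  have lin: "Vector_Spaces.linear s s a"
    unfolding Vector_Spaces.linear_iff
  proof (intro conjI allI)
    show "a (x + y) = a x + a y" for x y
      unfolding a_def sum.distrib[symmetric]
      by (rule sum.cong) (simp_all add: functional_arith(1)[OF l] scale_left_distrib)
    show "a (s c x) = s c (a x)" for c x
      unfolding a_def scale_sum_right by (rule sum.cong) (simp_all add: functional_arith(5)[OF l])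
  qed (rule vector_space_axioms)+
  have unique: "c i = d i" if "(\<Sum>i<k. s (c i) (v i)) = (\<Sum>i<k. s (d i) (v i))" "i < k" for c d i
  proof -
    define f where "f b = c (inv_into {..<k} v b) - d (inv_into {..<k} v b)" for b
    have inj: "inj_on v {..<k}" and im: "v ` {..<k} = B"
      using v by (auto simp: bij_betw_def)
    have "(\<Sum>b\<in>B. s (f b) b) = (\<Sum>i<k. s (c i - d i) (v i))"
      unfolding im[symmetric] by (subst sum.reindex[OF inj]) (simp add: f_def inv_into_f_f[OF inj])
    also have "\<dots> = 0"
      using that(1) by (simp add: scale_left_diff_distrib sum_subtractf)
    finally have "f (v i) = 0"
      using independentD[OF B(2) finiteI_independent[OF B(2)] order_refl] that(2) im by auto
    then show ?thesis
      using that(2) by (simp add: f_def inv_into_f_f[OF inj])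
  qed
  have inj: "inj_on a V"
  proof (rule inj_onI)
    fix x y assume xy: "x \<in> V" "y \<in> V" "a x = a y"
    then have "\<forall>i<k. l i x = l i y"
      using unique[of "\<lambda>i. l i x" "\<lambda>i. l i y"] by (auto simp: a_def)
    then have "x - y = 0"
      using xy sub by (intro ker) (auto simp: functional_arith(2)[OF l] subspace_diff)
    then show "x = y"
      by simp
  qed
  have vB: "v i \<in> V" if "i < k" for i
    using v B(1) that by (auto simp: bij_betw_def)
  have aV: "a ` V \<subseteq> V"
    using vB by (auto simp: a_def intro!: subspace_sum[OF sub] subspace_scale[OF sub])
  interpret p: finite_dimensional_vector_space_pair_1 s Basis s
    by unfold_locales
  have "a ` V = V"
  proof (rule subspace_dim_equal[OF _ sub aV])
    show "subspace (a ` V)"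
      using lin sub by (rule module_hom.subspace_image[OF linear_iff_module_hom[THEN iffD1]])
    have "span V = V"
      using sub by simp
    then have "dim (a ` V) = dim V"
      using p.dim_image_eq[OF lin, of V] inj by metis
    then show "dim V \<le> dim (a ` V)"
      by simp
  qed
  then obtain w where w: "w \<in> V" "a w = v j"
    using vB[OF j] by (metis imageE)
  have "v j = (\<Sum>i<k. s (if i = j then 1 else 0) (v i))"
    using j by (simp add: if_distrib[of "\<lambda>c. s c _"] cong: if_cong)
  then have "(\<Sum>i<k. s (l i w) (v i)) = (\<Sum>i<k. s (if i = j then 1 else 0) (v i))"
    using w by (simp add: a_def)
  then show ?thesis
    using unique[of "\<lambda>i. l i w" "\<lambda>i. if i = j then 1 else 0"] w(1) by blast
qed

text \<open>
  Coordinates of a subspace in a chart are always computed by exhibiting its frame.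
\<close>

lemma chart_frameI:
  assumes V: "V \<in> grass_chart s k l" and l: "\<And>i. i < k \<Longrightarrow> functional s (l i)"
    and w: "w \<in> V" "\<And>i. i < k \<Longrightarrow> l i w = (if i = j then 1 else 0)"
  shows "chart_frame k l V j = w"
  unfolding chart_frame_def
proof (rule the_equality)
  fix v assume v: "v \<in> V \<and> (\<forall>i<k. l i v = (if i = j then 1 else 0))"
  have "v - w = 0"
  proof -
    have "v - w \<in> V"
      using V v w(1) by (auto simp: grass_chart_def grass_def subspace_diff)
    moreover have "\<forall>i<k. l i (v - w) = 0"
      using v w(2) by (simp add: functional_arith(2)[OF l])
    ultimately show ?thesis
      using V by (auto simp: grass_chart_def)
  qed
  then show "v = w"
    by simp
qed (use w in auto)

lemma chart_frame:
  assumes V: "V \<in> grass_chart s k l" and l: "\<And>i. i < k \<Longrightarrow> functional s (l i)" and j: "j < k"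
  shows "chart_frame k l V j \<in> V" "i < k \<Longrightarrow> l i (chart_frame k l V j) = (if i = j then 1 else 0)"
  using grass_chart_dual_frame[OF V l j] chart_frameI[OF V l, of _ j] by auto

lemma chart_frame_expand:
  assumes V: "V \<in> grass_chart s k l" and l: "\<And>i. i < k \<Longrightarrow> functional s (l i)" and x: "x \<in> V"
  shows "x = (\<Sum>j<k. s (l j x) (chart_frame k l V j))"
  using V chart_frame[OF V l] x by (intro dual_family_expand[OF _ l]) (auto simp: grass_chart_def)

lemma grass_chart_exists:
  assumes "V \<in> grass s k"
  shows "\<exists>l. (\<forall>i<k. functional s (l i)) \<and> V \<in> grass_chart s k l"
proof -
  obtain B where B: "B \<subseteq> V" "independent B" "V \<subseteq> span B" "card B = k"
    using basis_exists[of V] assms by (auto simp: grass_def)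
  then obtain v where v: "bij_betw v {..<k} B"
    using ex_bij_betw_nat_finite[OF finiteI_independent[OF B(2)]] by (auto simp: atLeast0LessThan)
  define l where "l i x = representation (extend_basis B) x (v i)" for i x
  note ext = independent_extend_basis[OF B(2)] span_extend_basis[OF B(2)] extend_basis_superset[OF B(2)]
  have l: "functional s (l i)" for i
    unfolding l_def by (rule functionalI) (simp_all add: representation_add representation_scale ext)
  have vB: "v i \<in> B" if "i < k" for i
    using v that by (auto simp: bij_betw_def)
  have "l i (v j) = (if i = j then 1 else 0)" if "i < k" "j < k" for i j
  proof -
    have "v i = v j \<longleftrightarrow> i = j"
      using inj_on_eq_iff[OF bij_betw_imp_inj_on[OF v]] that by simp
    then show ?thesis
      using representation_basis[OF ext(1), of "v j"] subsetD[OF ext(3) vB[OF that(2)]] that(1)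
      by (simp add: l_def)
  qed
  then have "V \<in> grass_chart s k l"
    using vB B(1) by (intro grass_chart_dualI[OF assms l, of v]) auto
  then show ?thesis
    using l by blast
qed

end

section \<open>Skew forms and hyperbolic systems\<close>

text \<open>
  Partial symplectic bases.
\<close>

definition hyperbolic ::
    "('v \<Rightarrow> 'v \<Rightarrow> complex) \<Rightarrow> nat \<Rightarrow> (nat \<Rightarrow> 'v) \<Rightarrow> (nat \<Rightarrow> 'v) \<Rightarrow> bool" where
  "hyperbolic \<omega> m a b \<longleftrightarrow>
     (\<forall>i<m. \<forall>j<m. \<omega> (a i) (a j) = 0 \<and> \<omega> (b i) (b j) = 0 \<and> \<omega> (a i) (b j) = (if i = j then 1 else 0))"

text \<open>
  The coordinates of \<open>x\<close> with respect to a hyperbolic system are \<open>\<omega> x (b i)\<close> and \<open>\<omega> (a i) x\<close>. Placing them on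
  another system gives the linear map that sends \<open>a i\<close> to \<open>a' i\<close> and \<open>b i\<close> to \<open>b' i\<close> and kills the
  orthogonal complement; for \<open>a' = a\<close> and \<open>b' = b\<close> it is the orthogonal projection onto the span.
\<close>

definition transfer ::
    "(complex \<Rightarrow> 'w::ab_group_add \<Rightarrow> 'w) \<Rightarrow> ('v \<Rightarrow> 'v \<Rightarrow> complex) \<Rightarrow> (nat \<Rightarrow> 'v) \<Rightarrow> (nat \<Rightarrow> 'v) \<Rightarrow>
     (nat \<Rightarrow> 'w) \<Rightarrow> (nat \<Rightarrow> 'w) \<Rightarrow> nat \<Rightarrow> 'v \<Rightarrow> 'w" where
  "transfer s' \<omega> a b a' b' m x = (\<Sum>i<m. s' (\<omega> x (b i)) (a' i) + s' (\<omega> (a i) x) (b' i))"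

text \<open>
  Every vector minus its projection is orthogonal to the system. In a complete one the orthogonal
  complement is as small as possible: it is the kernel of the form.
\<close>

definition complete_system ::
    "(complex \<Rightarrow> 'v::ab_group_add \<Rightarrow> 'v) \<Rightarrow> ('v \<Rightarrow> 'v \<Rightarrow> complex) \<Rightarrow> nat \<Rightarrow>
     (nat \<Rightarrow> 'v) \<Rightarrow> (nat \<Rightarrow> 'v) \<Rightarrow> bool" where
  "complete_system s \<omega> m a b \<longleftrightarrow>
     hyperbolic \<omega> m a b \<and> (\<forall>x. x - transfer s \<omega> a b a b m x \<in> form_kernel \<omega>)"

locale skew_space = complex_space s Basis
  for s :: "complex \<Rightarrow> 'v::ab_group_add \<Rightarrow> 'v" and Basis :: "'v set" +
  fixes \<omega> :: "'v \<Rightarrow> 'v \<Rightarrow> complex"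
  assumes skew_form: "skew_form s \<omega>"
begin

lemma form_functional: "functional s (\<omega> x)" "functional s (\<lambda>x. \<omega> x y)"
  using skew_form unfolding skew_form_def by blast+

lemma form_swap: "\<omega> x y = - \<omega> y x"
  using skew_form unfolding skew_form_def by blast

lemma form_self: "\<omega> x x = 0"
proof -
  have "2 * \<omega> x x = 0"
    unfolding mult_2 using form_swap[of x x] by (simp only: eq_neg_iff_add_eq_0)
  then show ?thesis
    by simp
qed

lemmas form_arith = functional_arith[OF form_functional(1)] functional_arith[OF form_functional(2)]

lemma form_sum:
  "\<omega> (sum f I) y = (\<Sum>i\<in>I. \<omega> (f i) y)" "\<omega> y (sum f I) = (\<Sum>i\<in>I. \<omega> y (f i))"
  using module_hom.sum[OF linear_iff_module_hom[THEN iffD1, OF form_functional(1)]]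
    module_hom.sum[OF linear_iff_module_hom[THEN iffD1, OF form_functional(2)]] by auto

lemma transfer_linear:
  assumes "vector_space s'"
  shows "Vector_Spaces.linear s s' (transfer s' \<omega> a b a' b' m)"
proof -
  interpret t: vector_space s' by fact
  show ?thesis
    unfolding Vector_Spaces.linear_iff transfer_def using vector_space_axioms t.vector_space_axioms
    by (auto simp: form_arith t.scale_left_distrib t.scale_sum_right t.scale_right_distrib sum.distrib
        algebra_simps)
qed

lemma form_transfer_left:
  "\<omega> (transfer s \<omega>0 a0 b0 a b m x) z =
     (\<Sum>i<m. \<omega>0 x (b0 i) * \<omega> (a i) z + \<omega>0 (a0 i) x * \<omega> (b i) z)"
  by (simp add: transfer_def form_sum form_arith)

text \<open>
  A transferred vector has the same coordinates as the original one.
\<close>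

lemma form_transfer_right:
  assumes "hyperbolic \<omega> m a b" "i < m"
  shows "\<omega> (a i) (transfer s \<omega>0 a0 b0 a b m x) = \<omega>0 (a0 i) x"
    "\<omega> (b i) (transfer s \<omega>0 a0 b0 a b m x) = - \<omega>0 x (b0 i)"
proof -
  have ba: "\<omega> (b i) (a j) = (if i = j then -1 else 0)" if "j < m" for j
    using assms that form_swap[of "b i" "a j"] by (auto simp: hyperbolic_def)
  have "\<omega> (a i) (transfer s \<omega>0 a0 b0 a b m x) = (\<Sum>j<m. if i = j then \<omega>0 (a0 j) x else 0)"
    unfolding transfer_def form_sum using assms
    by (intro sum.cong) (auto simp: form_arith hyperbolic_def)
  then show "\<omega> (a i) (transfer s \<omega>0 a0 b0 a b m x) = \<omega>0 (a0 i) x"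
    using assms by simp
  have "\<omega> (b i) (transfer s \<omega>0 a0 b0 a b m x) = (\<Sum>j<m. if i = j then - \<omega>0 x (b0 j) else 0)"
    unfolding transfer_def form_sum using assms
    by (intro sum.cong) (auto simp: form_arith hyperbolic_def ba)
  then show "\<omega> (b i) (transfer s \<omega>0 a0 b0 a b m x) = - \<omega>0 x (b0 i)"
    using assms by simp
qed

lemma transfer_transfer:
  assumes "hyperbolic \<omega> m a b"
  shows "transfer s2 \<omega> a b a2 b2 m (transfer s \<omega>0 a0 b0 a b m x) = transfer s2 \<omega>0 a0 b0 a2 b2 m x"
  unfolding transfer_def[of s2]
  by (intro sum.cong refl)
    (simp add: form_transfer_right[OF assms] form_swap[of "transfer s \<omega>0 a0 b0 a b m x" "b _"])

lemma transfer_basis: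
  assumes "hyperbolic \<omega> m a b" "i < m" "vector_space s'"
  shows "transfer s' \<omega> a b a' b' m (a i) = a' i"
proof -
  interpret t: vector_space s' by fact
  have "transfer s' \<omega> a b a' b' m (a i) = (\<Sum>j<m. if i = j then a' j else 0)"
    unfolding transfer_def using assms(1,2) by (intro sum.cong) (auto simp: hyperbolic_def)
  then show ?thesis
    using assms(2) by simp
qed

lemma transfer_complete:
  assumes "complete_system s \<omega> m a b"
  shows "\<omega> (transfer s \<omega> a b a b m x) y = \<omega> x y"
  using assms by (simp add: complete_system_def form_kernel_def form_arith)

lemma transfer_nondegenerate:
  assumes "complete_system s \<omega> m a b" "form_kernel \<omega> = {0}"
  shows "transfer s \<omega> a b a b m x = x"
  using assms by (auto simp: complete_system_def)

text \<open>
  In the coordinates of a hyperbolic system the form is the same sum for every space, and modulo the kernel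
  a vector is determined by its coordinates if the system is complete.
\<close>

lemma transfer_isometry:
  assumes "complete_system s \<omega> m a b" and "skew_space s' B' \<omega>'" and "hyperbolic \<omega>' m a' b'"
  shows "\<omega>' (transfer s' \<omega> a b a' b' m x) (transfer s' \<omega> a b a' b' m y) = \<omega> x y"
proof -
  interpret t: skew_space s' B' \<omega>' by fact
  have "\<omega>' (transfer s' \<omega> a b a' b' m x) (transfer s' \<omega> a b a' b' m y)
      = (\<Sum>i<m. \<omega> x (b i) * \<omega> (a i) y + \<omega> (a i) x * \<omega> (b i) y)"
    unfolding t.form_transfer_left
    by (intro sum.cong refl) (simp add: t.form_transfer_right[OF assms(3)] form_swap[of "b _" y])
  also have "\<dots> = \<omega> x y"
    using transfer_complete[OF assms(1), of x y] by (simp add: form_transfer_left)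
  finally show ?thesis .
qed

text \<open>
  The \<open>a i\<close> followed by the \<open>b i\<close>, so that the lemmas on dual families apply to a hyperbolic system, with
  the next definition as the dual functionals.
\<close>

definition system_vector :: "nat \<Rightarrow> (nat \<Rightarrow> 'v) \<Rightarrow> (nat \<Rightarrow> 'v) \<Rightarrow> nat \<Rightarrow> 'v" where
  "system_vector m a b j = (if j < m then a j else b (j - m))"

definition system_coord :: "nat \<Rightarrow> (nat \<Rightarrow> 'v) \<Rightarrow> (nat \<Rightarrow> 'v) \<Rightarrow> nat \<Rightarrow> 'v \<Rightarrow> complex" where
  "system_coord m a b j x = (if j < m then \<omega> x (b j) else \<omega> (a (j - m)) x)"

lemma system_coord_functional: "functional s (system_coord m a b j)"
  unfolding system_coord_def by (cases "j < m") (simp_all add: form_functional)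

lemma system_dual:
  assumes "hyperbolic \<omega> m a b" "i < 2 * m" "j < 2 * m"
  shows "system_coord m a b i (system_vector m a b j) = (if i = j then 1 else 0)"
  using assms
  by (auto simp: system_coord_def system_vector_def hyperbolic_def)

lemma hyperbolic_card_le:
  assumes "hyperbolic \<omega> m a b"
  shows "2 * m \<le> dim UNIV"
proof -
  note ind = dual_family_independent[OF system_coord_functional[of m a b] system_dual[OF assms], of "2 * m", simplified]
  have "card (system_vector m a b ` {..<2 * m}) \<le> dim UNIV"
    using independent_card_le_dim[OF subset_UNIV ind(2)] by simp
  then show ?thesis
    using card_image[OF ind(1)] by simp
qed

text \<open>
  If two vectors orthogonal to the system pair nontrivially, then after rescaling one of them they form a
  further pair. Otherwise the orthogonal complement is isotropic and orthogonal to the whole space, so the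
  system is complete. The process ends because the vectors of a system are linearly independent.
\<close>

lemma hyperbolic_extend:
  assumes "hyperbolic \<omega> m a b"
  shows "\<exists>m' a' b'. m \<le> m' \<and> complete_system s \<omega> m' a' b' \<and> (\<forall>i<m. a' i = a i \<and> b' i = b i)"
  using assms
proof (induction "dim UNIV - 2 * m" arbitrary: m a b rule: less_induct)
  case less
  \<comment> \<open>The component orthogonal to the system.\<close>
  define r where "r x = x - transfer s \<omega> a b a b m x" for x
  have ra: "\<omega> (a i) (r x) = 0" and rb: "\<omega> (b i) (r x) = 0" if "i < m" for i x
    using form_transfer_right[OF less.prems that, of \<omega> a b x] form_swap[of "b i" x]
    by (auto simp: r_def form_arith)
  have ar: "\<omega> (r x) (a i) = 0" and br: "\<omega> (r x) (b i) = 0" if "i < m" for i x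
    using ra[OF that, of x] rb[OF that, of x] form_swap[of "r x" "a i"] form_swap[of "r x" "b i"]
    by auto
  show ?case
  proof (cases "\<exists>x y. \<omega> (r x) (r y) \<noteq> 0")
    case True
    then obtain x y where xy: "\<omega> (r x) (r y) \<noteq> 0"
      by blast
    define a' where "a' i = (if i = m then r x else a i)" for i
    define b' where "b' i = (if i = m then s (1 / \<omega> (r x) (r y)) (r y) else b i)" for i
    have h: "hyperbolic \<omega> (Suc m) a' b'"
      using less.prems xy ra rb ar br
      by (auto simp: hyperbolic_def a'_def b'_def form_arith form_self less_Suc_eq)
    have "dim UNIV - 2 * Suc m < dim UNIV - 2 * m"
      using hyperbolic_card_le[OF h] by simp
    from less.hyps[OF this h] obtain m' a'' b'' where
      "Suc m \<le> m'" "complete_system s \<omega> m' a'' b''" "\<forall>i<Suc m. a'' i = a' i \<and> b'' i = b' i"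
      by blast
    then show ?thesis
      by (intro exI[of _ m'] exI[of _ a''] exI[of _ b'']) (auto simp: a'_def b'_def)
  next
    case False
    have "\<omega> (r x) y = 0" for x y
    proof -
      have "\<omega> (r x) y = \<omega> (r x) (r y) + \<omega> (r x) (transfer s \<omega> a b a b m y)"
        by (simp add: r_def form_arith)
      also have "\<omega> (r x) (transfer s \<omega> a b a b m y) = 0"
        unfolding transfer_def form_sum by (intro sum.neutral) (auto simp: form_arith ar br)
      finally show ?thesis
        using False by simp
    qed
    then have "complete_system s \<omega> m a b"
      using less.prems by (auto simp: complete_system_def form_kernel_def r_def)
    then show ?thesis
      by blast
  qed
qed

lemma complete_system_exists: "\<exists>m a b. complete_system s \<omega> m a b"
  using hyperbolic_extend[of 0] by (auto simp: hyperbolic_def)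

lemma complete_system_coord_eq_0:
  assumes "complete_system s \<omega> m a b" "\<forall>i<2 * m. system_coord m a b i x = 0"
  shows "x \<in> form_kernel \<omega>"
proof -
  have "\<omega> x (b i) = 0" "\<omega> (a i) x = 0" if "i < m" for i
    using assms(2)[rule_format, of i] assms(2)[rule_format, of "m + i"] that
    by (auto simp: system_coord_def)
  then have "transfer s \<omega> a b a b m x = 0"
    by (simp add: transfer_def)
  then show ?thesis
    using assms(1) unfolding complete_system_def by (metis diff_zero)
qed

lemma complete_system_size:
  assumes c: "complete_system s \<omega> m a b" and ker: "form_kernel \<omega> = {0}"
  shows "dim UNIV = 2 * m"
proof -
  have h: "hyperbolic \<omega> m a b"
    using c by (simp add: complete_system_def)
  have "UNIV \<in> grass_chart s (2 * m) (system_coord m a b)"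
    using complete_system_coord_eq_0[OF c] ker
    by (intro grass_chartI[OF subspace_UNIV system_coord_functional _ system_dual[OF h]]) auto
  then show ?thesis
    unfolding grass_chart_def grass_def by blast
qed

text \<open>
  With coordinates given by the form, \<open>f x = \<Sum>i. \<omega> x (b i) * f (a i) + \<omega> (a i) x * f (b i)\<close>, and the
  right-hand side is \<open>\<omega>\<close> of \<open>x\<close> with a fixed vector.
\<close>

lemma functional_represented:
  assumes c: "complete_system s \<omega> m a b" and ker: "form_kernel \<omega> = {0}" and f: "functional s f"
  shows "\<exists>y. \<forall>x. f x = \<omega> x y"
proof -
  define y where "y = (\<Sum>i<m. s (f (a i)) (b i) - s (f (b i)) (a i))"
  have "f x = \<omega> x y" for x
  proof -
    have "f x = f (transfer s \<omega> a b a b m x)"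
      using transfer_nondegenerate[OF c ker] by simp
    also have "\<dots> = (\<Sum>i<m. \<omega> x (b i) * f (a i) + \<omega> (a i) x * f (b i))"
      unfolding transfer_def module_hom.sum[OF linear_iff_module_hom[THEN iffD1, OF f]]
      by (simp add: functional_arith[OF f])
    also have "\<dots> = \<omega> x y"
      unfolding y_def form_sum
      by (intro sum.cong refl) (simp add: form_arith form_swap[of x "a _"])
    finally show ?thesis .
  qed
  then show ?thesis
    by blast
qed

text \<open>
  Representing the coordinates of a chart around \<open>U\<close> by vectors \<open>c j\<close> gives partners of a basis \<open>u\<close> of \<open>U\<close>.
  These need not be orthogonal to each other, but subtracting \<open>\<Sum>l. (\<omega> (c j) (c l) / 2) \<cdot> u l\<close> from \<open>c j\<close>
  makes them so without changing their pairing with the isotropic space \<open>U\<close>.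
\<close>

lemma isotropic_in_complete_system:
  assumes ker: "form_kernel \<omega> = {0}" and U: "U \<in> isotropic_grass s \<omega> d"
  shows "\<exists>m a b. d \<le> m \<and> complete_system s \<omega> m a b \<and> U = span (a ` {..<d})"
proof -
  have U': "U \<in> grass s d" and iso: "\<And>x y. x \<in> U \<Longrightarrow> y \<in> U \<Longrightarrow> \<omega> x y = 0"
    using U by (auto simp: isotropic_grass_def)
  obtain l where l: "\<And>i. i < d \<Longrightarrow> functional s (l i)" and chart: "U \<in> grass_chart s d l"
    using grass_chart_exists[OF U'] by blast
  define u where "u = chart_frame d l U"
  note frame = chart_frame[OF chart l, folded u_def]
  obtain m0 a0 b0 where "complete_system s \<omega> m0 a0 b0"
    using complete_system_exists by blast
  then have "\<forall>j. \<exists>y. j < d \<longrightarrow> (\<forall>x. l j x = \<omega> x y)"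
    using functional_represented[OF _ ker l] by blast
  then obtain c where c: "\<And>j x. j < d \<Longrightarrow> l j x = \<omega> x (c j)"
    by metis
  have uc: "\<omega> (u i) (c j) = (if i = j then 1 else 0)" if "i < d" "j < d" for i j
    using frame(2)[of i j] c[OF that(2), of "u i"] that by auto
  \<comment> \<open>Half of the defect on each side: the pairing of \<open>b i\<close> and \<open>b j\<close> receives both corrections.\<close>
  define b where "b j = c j - (\<Sum>l<d. s (\<omega> (c j) (c l) / 2) (u l))" for j
  have ub: "\<omega> (u i) (b j) = (if i = j then 1 else 0)" if "i < d" "j < d" for i j
    using that uc iso frame(1) by (simp add: b_def form_arith form_sum)
  have bb: "\<omega> (b i) (b j) = 0" if "i < d" "j < d" for i j
  proof -
    have "\<omega> (c i) (\<Sum>l<d. s (\<omega> (c j) (c l) / 2) (u l))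
        = (\<Sum>l<d. if i = l then - (\<omega> (c j) (c l) / 2) else 0)"
      unfolding form_sum using that uc
      by (intro sum.cong refl) (simp add: form_arith form_swap[of "c i" "u _"])
    then have 1: "\<omega> (c i) (b j) = \<omega> (c i) (c j) + \<omega> (c j) (c i) / 2"
      using that by (simp add: b_def form_arith)
    have "\<omega> (\<Sum>l<d. s (\<omega> (c i) (c l) / 2) (u l)) (b j)
        = (\<Sum>l<d. if j = l then \<omega> (c i) (c l) / 2 else 0)"
      unfolding form_sum using that ub by (intro sum.cong) (auto simp: form_arith)
    then have "\<omega> (b i) (b j) = \<omega> (c i) (b j) - \<omega> (c i) (c j) / 2"
      using that by (subst b_def) (simp add: form_arith)
    then show ?thesis
      using 1 form_swap[of "c j" "c i"] by simp
  qed
  have "hyperbolic \<omega> d u b"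
    using ub bb iso frame(1) by (auto simp: hyperbolic_def)
  then obtain m a' b' where m: "d \<le> m" "complete_system s \<omega> m a' b'" "\<forall>i<d. a' i = u i \<and> b' i = b i"
    using hyperbolic_extend by blast
  have "span (u ` {..<d}) \<subseteq> U"
    using U' frame(1) by (intro span_minimal) (auto simp: grass_def)
  moreover have "U \<subseteq> span (u ` {..<d})"
  proof
    fix x assume "x \<in> U"
    then have "x = (\<Sum>j<d. s (l j x) (u j))"
      using chart_frame_expand[OF chart l] by (simp add: u_def)
    also have "\<dots> \<in> span (u ` {..<d})"
      by (intro span_sum span_scale span_base) auto
    finally show "x \<in> span (u ` {..<d})" .
  qed
  moreover have "a' ` {..<d} = u ` {..<d}"
    using m(3) by (intro image_cong) auto
  ultimately show ?thesis
    using m(1,2) by (intro exI[of _ m] exI[of _ a'] exI[of _ b']) auto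
qed

text \<open>
  Complete the two subspaces to symplectic bases of the whole space, and transfer one basis to the other.
\<close>

lemma witt_isometry:
  assumes ker: "form_kernel \<omega> = {0}"
    and U: "U \<in> isotropic_grass s \<omega> d" and U': "U' \<in> isotropic_grass s \<omega> d"
  shows "\<exists>h h'. Vector_Spaces.linear s s h \<and> Vector_Spaces.linear s s h' \<and>
    (\<forall>x. h' (h x) = x) \<and> (\<forall>x. h (h' x) = x) \<and> (\<forall>x y. \<omega> (h x) (h y) = \<omega> x y) \<and>
    h ` U \<subseteq> U' \<and> h' ` U' \<subseteq> U"
proof -
  obtain m a b where c: "d \<le> m" "complete_system s \<omega> m a b" "U = span (a ` {..<d})"
    using isotropic_in_complete_system[OF ker U] by blast
  obtain m' a' b' where c': "d \<le> m'" "complete_system s \<omega> m' a' b'" "U' = span (a' ` {..<d})"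
    using isotropic_in_complete_system[OF ker U'] by blast
  have [simp]: "m' = m"
    using complete_system_size[OF c(2) ker] complete_system_size[OF c'(2) ker] by simp
  have h: "hyperbolic \<omega> m a b" "hyperbolic \<omega> m a' b'"
    using c(2) c'(2) by (auto simp: complete_system_def)
  have image: "transfer s \<omega> a b a' b' m ` span (a ` {..<d}) \<subseteq> span (a' ` {..<d})"
    if h: "hyperbolic \<omega> m a b" for a b a' b'
  proof -
    have "transfer s \<omega> a b a' b' m ` span (a ` {..<d}) = span (transfer s \<omega> a b a' b' m ` a ` {..<d})"
      using module_hom.span_image[OF linear_iff_module_hom[THEN iffD1, OF transfer_linear]]
        vector_space_axioms by metis
    also have "transfer s \<omega> a b a' b' m ` a ` {..<d} = a' ` {..<d}"
      unfolding image_image using c(1)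
      by (intro image_cong refl transfer_basis[OF h _ vector_space_axioms]) auto
    finally show ?thesis
      by simp
  qed
  show ?thesis
  proof (intro exI conjI allI)
    show "Vector_Spaces.linear s s (transfer s \<omega> a b a' b' m)"
      "Vector_Spaces.linear s s (transfer s \<omega> a' b' a b m)"
      by (rule transfer_linear, rule vector_space_axioms)+
    show "transfer s \<omega> a' b' a b m (transfer s \<omega> a b a' b' m x) = x" for x
      by (simp only: transfer_transfer[OF h(2)] transfer_nondegenerate[OF c(2) ker])
    show "transfer s \<omega> a b a' b' m (transfer s \<omega> a' b' a b m x) = x" for x
      by (simp only: transfer_transfer[OF h(1)] transfer_nondegenerate[OF c'(2)[simplified] ker])
    show "\<omega> (transfer s \<omega> a b a' b' m x) (transfer s \<omega> a b a' b' m y) = \<omega> x y" for x y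
      by (rule transfer_isometry[OF c(2) skew_space_axioms h(2)])
    show "transfer s \<omega> a b a' b' m ` U \<subseteq> U'" "transfer s \<omega> a' b' a b m ` U' \<subseteq> U"
      using image[OF h(1), of a' b'] image[OF h(2), of a b] by (simp_all add: c(3) c'(3))
  qed
qed

text \<open>
  The first \<open>d\<close> of the vectors \<open>a i\<close> of a complete system span such a subspace.
\<close>

lemma isotropic_exists:
  assumes ker: "form_kernel \<omega> = {0}" and d: "2 * d \<le> dim UNIV"
  shows "isotropic_grass s \<omega> d \<noteq> {}"
proof -
  obtain m a b where c: "complete_system s \<omega> m a b"
    using complete_system_exists by blast
  then have h: "hyperbolic \<omega> m a b"
    by (simp add: complete_system_def)
  have dm: "d \<le> m"
    using complete_system_size[OF c ker] d by simp
  have ab: "\<omega> (a j) (b i) = (if i = j then 1 else 0)" and aa: "\<omega> (a i) (a j) = 0"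
    if "i < d" "j < d" for i j
    using h that dm by (auto simp: hyperbolic_def)
  note ind = dual_family_independent[OF form_functional(2) ab, of d, simplified]
  have "span (a ` {..<d}) \<in> grass s d"
    using dim_span_eq_card_independent[OF ind(2)] card_image[OF ind(1)] by (simp add: grass_def)
  moreover have "\<omega> x y = 0" if x: "x \<in> span (a ` {..<d})" and y: "y \<in> span (a ` {..<d})" for x y
  proof -
    have sub: "subspace {x. \<omega> x z = 0}" "subspace {x. \<omega> z x = 0}" for z
      by (auto simp: subspace_def form_arith)
    have "\<omega> (a i) y = 0" if "i < d" for i
      using span_minimal[OF _ sub(2)[of "a i"], of "a ` {..<d}"] aa[OF that] y by auto
    then show ?thesis
      using span_minimal[OF _ sub(1)[of y], of "a ` {..<d}"] x by auto
  qed
  ultimately show ?thesis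
    unfolding isotropic_grass_def by blast
qed

end

section \<open>Atlases of isotropic Grassmannians and of the dual tautological bundle\<close>

definition frame_coords ::
    "(complex \<Rightarrow> 'v::ab_group_add \<Rightarrow> 'v) \<Rightarrow> nat \<Rightarrow> (nat \<Rightarrow> 'v \<Rightarrow> complex) \<Rightarrow> ('v set \<Rightarrow> complex) set" where
  "frame_coords s k l = {\<lambda>V. m (chart_frame k l V j) | m j. functional s m \<and> j < k}"

lemma frame_coord_poly:
  "functional s m \<Longrightarrow> j < k \<Longrightarrow> (\<lambda>V. m (chart_frame k l V j)) \<in> polys (frame_coords s k l)"
  by (rule polys.coord) (auto simp: frame_coords_def)

lemma isotropic_grass_variety_eq:
  "isotropic_grass_variety s \<omega> k =
     {(grass_chart s k l \<inter> isotropic_grass s \<omega> k, frame_coords s k l) | l. \<forall>i<k. functional s (l i)}"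
  unfolding isotropic_grass_variety_def subvariety_def grass_variety_def frame_coords_def by blast

lemma isotropic_subvariety_eq:
  "subvariety (isotropic_grass_variety s \<omega> k) Y =
     {(grass_chart s k l \<inter> isotropic_grass s \<omega> k \<inter> Y, frame_coords s k l) | l. \<forall>i<k. functional s (l i)}"
  unfolding isotropic_grass_variety_eq subvariety_def by blast

definition dual_coords ::
    "(complex \<Rightarrow> 'v::ab_group_add \<Rightarrow> 'v) \<Rightarrow> nat \<Rightarrow> (nat \<Rightarrow> 'v \<Rightarrow> complex) \<Rightarrow>
     ('v set \<times> ('v \<Rightarrow> complex) \<Rightarrow> complex) set" where
  "dual_coords s k l = {\<lambda>(V, \<phi>). p V | p. p \<in> frame_coords s k l} \<union>
     {\<lambda>(V, \<phi>). \<phi> (chart_frame k l V j) | j. j < k}"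

lemma dual_taut_variety_eq:
  "dual_taut_variety s \<omega> k =
     {(Sigma (grass_chart s k l \<inter> isotropic_grass s \<omega> k) (dual_space s), dual_coords s k l) | l.
        \<forall>i<k. functional s (l i)}"
  unfolding dual_taut_variety_def dual_coords_def frame_coords_def by blast

lemma dual_coords_cases:
  assumes "p \<in> dual_coords s k l"
  obtains m j where "functional s m" "j < k" "p = (\<lambda>(V, \<phi>). m (chart_frame k l V j))"
  | j where "j < k" "p = (\<lambda>(V, \<phi>). \<phi> (chart_frame k l V j))"
  using assms unfolding dual_coords_def frame_coords_def by blast

lemma dual_coord_poly_base:
  assumes "functional s m" "j < k"
  shows "(\<lambda>x. m (chart_frame k l (fst x) j)) \<in> polys (dual_coords s k l)"
proof -
  have "(\<lambda>V. m (chart_frame k l V j)) \<in> frame_coords s k l"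
    unfolding frame_coords_def using assms by blast
  then have "(\<lambda>(V, \<phi>). m (chart_frame k l V j)) \<in> dual_coords s k l"
    unfolding dual_coords_def
    by (intro UnI1 CollectI exI[of _ "\<lambda>V. m (chart_frame k l V j)"] conjI refl)
  then show ?thesis
    by (intro polys.coord) (simp add: case_prod_beta')
qed

lemma dual_coord_poly_fibre:
  assumes "j < k"
  shows "(\<lambda>x. snd x (chart_frame k l (fst x) j)) \<in> polys (dual_coords s k l)"
proof -
  have "(\<lambda>(V, \<phi>). \<phi> (chart_frame k l V j)) \<in> dual_coords s k l"
    unfolding dual_coords_def using assms by blast
  then show ?thesis
    by (intro polys.coord) (simp add: case_prod_beta')
qed

context skew_space
begin

lemma isotropic_in_chart:
  assumes "V \<in> isotropic_grass s \<omega> k"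
  shows "\<exists>l. (\<forall>i<k. functional s (l i)) \<and> V \<in> grass_chart s k l"
  using assms by (intro grass_chart_exists) (simp add: isotropic_grass_def)

lemma topspace_isotropic_subvariety:
  "topspace (zariski (subvariety (isotropic_grass_variety s \<omega> k) Y)) = isotropic_grass s \<omega> k \<inter> Y"
  unfolding isotropic_subvariety_eq topspace_zariski_family using isotropic_in_chart by blast

lemma topspace_isotropic_variety:
  "topspace (zariski (isotropic_grass_variety s \<omega> k)) = isotropic_grass s \<omega> k"
  unfolding isotropic_grass_variety_eq topspace_zariski_family using isotropic_in_chart by blast

lemma topspace_dual_taut_variety:
  "topspace (zariski (dual_taut_variety s \<omega> k)) = Sigma (isotropic_grass s \<omega> k) (dual_space s)"
  unfolding dual_taut_variety_eq topspace_zariski_family using isotropic_in_chart by blast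

end

section \<open>Splitting off the kernel of the form\<close>

context skew_space
begin

text \<open>
  A complete system and a generator of the kernel span the space.
\<close>

lemma dim_le_complete_system:
  assumes c: "complete_system s \<omega> m a b" and ker: "form_kernel \<omega> = span {e0}"
  shows "dim UNIV \<le> 2 * m + 1"
proof -
  let ?S = "insert e0 (a ` {..<m} \<union> b ` {..<m})"
  have "x \<in> span ?S" for x
  proof -
    have "x - transfer s \<omega> a b a b m x \<in> span {e0}"
      using c ker by (simp add: complete_system_def)
    then have "x - transfer s \<omega> a b a b m x \<in> span ?S"
      using span_mono[of "{e0}" ?S] by auto
    moreover have "transfer s \<omega> a b a b m x \<in> span ?S"
      unfolding transfer_def by (intro span_sum span_add span_scale span_base) auto
    ultimately show ?thesis
      using span_add by force
  qed
  then have "dim UNIV \<le> card ?S"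
    by (intro dim_le_card) auto
  also have "\<dots> \<le> Suc (card (a ` {..<m} \<union> b ` {..<m}))"
    by (rule card_insert_le_m1) auto
  also have "card (a ` {..<m} \<union> b ` {..<m}) \<le> card (a ` {..<m}) + card (b ` {..<m})"
    by (rule card_Un_le)
  also have "\<dots> \<le> m + m"
    by (intro add_mono) (use card_image_le[of "{..<m}"] in force)+
  finally show ?thesis
    by simp
qed

end

text \<open>
  \<open>E\<close> is the sum of a copy of \<open>F\<close>, embedded by \<open>\<iota>\<close>, and the line of \<open>e0\<close>; the two projections are \<open>\<pi>\<close> and
  \<open>\<eta>\<close>, and \<open>\<omega>\<close> is the pullback of \<open>\<sigma>\<close>.
\<close>

locale odd_splitting =
  E: skew_space sE BE \<omega> + F: skew_space sF BF \<sigma>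
  for sE :: "complex \<Rightarrow> 'e::ab_group_add \<Rightarrow> 'e" and BE and \<omega> :: "'e \<Rightarrow> 'e \<Rightarrow> complex"
    and sF :: "complex \<Rightarrow> 'f::ab_group_add \<Rightarrow> 'f" and BF and \<sigma> :: "'f \<Rightarrow> 'f \<Rightarrow> complex" +
  fixes e0 :: 'e and \<pi> :: "'e \<Rightarrow> 'f" and \<iota> :: "'f \<Rightarrow> 'e" and \<eta> :: "'e \<Rightarrow> complex"
  assumes nondegenerate: "form_kernel \<sigma> = {0}"
    and proj_linear: "Vector_Spaces.linear sE sF \<pi>"
    and emb_linear: "Vector_Spaces.linear sF sE \<iota>"
    and height_functional: "functional sE \<eta>"
    and proj_emb: "\<pi> (\<iota> u) = u" and height_emb: "\<eta> (\<iota> u) = 0"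
    and proj_e0: "\<pi> e0 = 0" and height_e0: "\<eta> e0 = 1"
    and decomposition: "\<iota> (\<pi> x) + sE (\<eta> x) e0 = x"
    and form_proj: "\<omega> x y = \<sigma> (\<pi> x) (\<pi> y)"

text \<open>
  The maps \<open>\<pi>\<close> and \<open>\<iota>\<close> transfer complete systems of \<open>E\<close> and \<open>F\<close> to each other, which is possible because both
  consist of \<open>n\<close> pairs. Then \<open>x - \<iota> (\<pi> x)\<close> is in the line of \<open>e0\<close>, and \<open>\<eta>\<close> is its coordinate there.
\<close>

lemma odd_splitting_exists:
  assumes E: "skew_space sE BE \<omega>" and F: "skew_space sF BF \<sigma>"
    and dimE: "vector_space.dim sE UNIV = 2 * n + 1" and dimF: "vector_space.dim sF UNIV = 2 * n"
    and kerE: "form_kernel \<omega> = module.span sE {e0}" and kerF: "form_kernel \<sigma> = {0}"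
  shows "\<exists>\<pi> \<iota> \<eta>. odd_splitting sE BE \<omega> sF BF \<sigma> e0 \<pi> \<iota> \<eta>"
proof -
  interpret E: skew_space sE BE \<omega> by fact
  interpret F: skew_space sF BF \<sigma> by fact
  obtain m a b where ab: "complete_system sE \<omega> m a b"
    using E.complete_system_exists by blast
  obtain m' a' b' where ab': "complete_system sF \<sigma> m' a' b'"
    using F.complete_system_exists by blast
  have h: "hyperbolic \<omega> m a b" and h': "hyperbolic \<sigma> m' a' b'"
    using ab ab' by (auto simp: complete_system_def)
  have "m' = n"
    using F.complete_system_size[OF ab' kerF] dimF by simp
  moreover have "m = n"
    using E.hyperbolic_card_le[OF h] E.dim_le_complete_system[OF ab kerE] dimE by simp
  ultimately have [simp]: "m = n" "m' = n"
    by simp_all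
  \<comment> \<open>A space with a nondegenerate skew form has even dimension.\<close>
  have e0: "e0 \<noteq> 0"
  proof
    assume "e0 = 0"
    then have "form_kernel \<omega> = {0}"
      using kerE by simp
    then show False
      using E.complete_system_size[OF ab] dimE by presburger
  qed
  then have ind: "E.independent {e0}"
    by simp
  define \<eta>0 where "\<eta>0 x = E.representation (E.extend_basis {e0}) x e0" for x
  note ext = E.independent_extend_basis[OF ind] E.span_extend_basis[OF ind] E.extend_basis_superset[OF ind]
  have \<eta>0: "functional sE \<eta>0"
    unfolding \<eta>0_def
    by (rule E.functionalI) (simp_all add: E.representation_add E.representation_scale ext)
  have \<eta>0_e0: "\<eta>0 e0 = 1"
    using E.representation_basis[OF ext(1), of e0] ext(3) by (simp add: \<eta>0_def)
  define \<pi> where "\<pi> = transfer sF \<omega> a b a' b' n"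
  define \<iota> where "\<iota> = transfer sE \<sigma> a' b' a b n"
  define \<eta> where "\<eta> x = \<eta>0 (x - \<iota> (\<pi> x))" for x
  have \<pi>: "Vector_Spaces.linear sE sF \<pi>"
    unfolding \<pi>_def by (rule E.transfer_linear[OF F.vector_space_axioms])
  have \<iota>: "Vector_Spaces.linear sF sE \<iota>"
    unfolding \<iota>_def by (rule F.transfer_linear[OF E.vector_space_axioms])
  have \<pi>\<iota>: "\<pi> (\<iota> u) = u" for u
    unfolding \<pi>_def \<iota>_def using ab'
    by (simp add: E.transfer_transfer[OF h[simplified]] F.transfer_nondegenerate[OF _ kerF])
  have \<iota>\<pi>: "\<iota> (\<pi> x) = transfer sE \<omega> a b a b n x" for x
    unfolding \<pi>_def \<iota>_def by (simp add: F.transfer_transfer[OF h'[simplified]])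
  have res: "x - \<iota> (\<pi> x) \<in> E.span {e0}" for x
    using ab kerE by (simp add: complete_system_def \<iota>\<pi>)
  have "e0 \<in> form_kernel \<omega>"
    unfolding kerE by (rule E.span_base) simp
  then have "\<omega> e0 y = 0" "\<omega> y e0 = 0" for y
    by (simp_all add: form_kernel_def E.form_swap[of y e0])
  then have \<pi>e0: "\<pi> e0 = 0"
    by (simp add: \<pi>_def transfer_def)
  have \<iota>0: "\<iota> 0 = 0"
    by (simp add: \<iota>_def transfer_def F.form_arith)
  have "odd_splitting sE BE \<omega> sF BF \<sigma> e0 \<pi> \<iota> \<eta>"
  proof (intro odd_splitting.intro odd_splitting_axioms.intro)
    show "functional sE \<eta>"
    proof (rule E.functionalI)
      have "\<pi> (x + y) = \<pi> x + \<pi> y" "\<pi> (sE c x) = sF c (\<pi> x)"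
        "\<iota> (u + v) = \<iota> u + \<iota> v" "\<iota> (sF c u) = sE c (\<iota> u)" for x y u v c
        using \<pi> \<iota> by (simp_all add: Vector_Spaces.linear_iff)
      note arith = this E.functional_arith[OF \<eta>0]
      show "\<eta> (x + y) = \<eta> x + \<eta> y" for x y
        by (simp add: \<eta>_def arith algebra_simps)
      show "\<eta> (sE c x) = c * \<eta> x" for c x
        by (simp add: \<eta>_def arith algebra_simps)
    qed
    show "\<eta> (\<iota> u) = 0" for u
      by (simp add: \<eta>_def \<pi>\<iota> E.functional_arith[OF \<eta>0])
    show "\<eta> e0 = 1"
      by (simp add: \<eta>_def \<pi>e0 \<iota>0 \<eta>0_e0)
    show "\<iota> (\<pi> x) + sE (\<eta> x) e0 = x" for x
    proof -
      obtain c where c: "x - \<iota> (\<pi> x) = sE c e0"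
        using res[of x] by (auto simp: E.span_singleton)
      then have "\<eta> x = c"
        by (simp add: \<eta>_def E.functional_arith[OF \<eta>0] \<eta>0_e0)
      then show ?thesis
        using c by (simp add: algebra_simps)
    qed
    show "\<omega> x y = \<sigma> (\<pi> x) (\<pi> y)" for x y
      unfolding \<pi>_def using E.transfer_isometry[of n a b, OF _ F] ab h' by simp
  qed (fact E F kerF \<pi> \<iota> \<pi>\<iota> \<pi>e0)+
  then show ?thesis
    by blast
qed

context odd_splitting
begin

lemma proj_arith:
  "\<pi> (x + y) = \<pi> x + \<pi> y" "\<pi> (sE c x) = sF c (\<pi> x)" "\<pi> (x - y) = \<pi> x - \<pi> y" "\<pi> 0 = 0"
  using proj_linear module_hom.diff[OF linear_iff_module_hom[THEN iffD1, OF proj_linear]]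
    module_hom.zero[OF linear_iff_module_hom[THEN iffD1, OF proj_linear]]
  by (auto simp: Vector_Spaces.linear_iff)

lemma emb_arith:
  "\<iota> (u + v) = \<iota> u + \<iota> v" "\<iota> (sF c u) = sE c (\<iota> u)" "\<iota> (u - v) = \<iota> u - \<iota> v" "\<iota> 0 = 0"
  using emb_linear module_hom.diff[OF linear_iff_module_hom[THEN iffD1, OF emb_linear]]
    module_hom.zero[OF linear_iff_module_hom[THEN iffD1, OF emb_linear]]
  by (auto simp: Vector_Spaces.linear_iff)

lemmas height_arith = E.functional_arith[OF height_functional]

lemma emb_proj: "\<iota> (\<pi> x) = x - sE (\<eta> x) e0"
  using decomposition[of x] by (simp add: algebra_simps)

lemma e0_nonzero: "e0 \<noteq> 0"
  using height_e0 height_arith(4) by auto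

lemma proj_eq_0_iff: "\<pi> x = 0 \<longleftrightarrow> x = sE (\<eta> x) e0"
  using decomposition[of x] by (metis add_0 emb_arith(4) proj_arith(2) proj_e0 F.scale_zero_right)

lemma eq_iff_proj_height: "x = y \<longleftrightarrow> \<pi> x = \<pi> y \<and> \<eta> x = \<eta> y"
  using decomposition by metis

lemma subspace_proj: "E.subspace V \<Longrightarrow> F.subspace (\<pi> ` V)"
  by (rule module_hom.subspace_image[OF linear_iff_module_hom[THEN iffD1, OF proj_linear]])

lemma functional_proj: "functional sF l \<Longrightarrow> functional sE (\<lambda>x. l (\<pi> x))"
  by (rule functional_compose[OF proj_linear])

lemma functional_emb: "functional sE l \<Longrightarrow> functional sF (\<lambda>u. l (\<iota> u))"
  by (rule functional_compose[OF emb_linear])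

lemma proj_surj: "range \<pi> = UNIV"
  using proj_emb by (metis surjI)

subsection \<open>Subspaces through the kernel are preimages\<close>

text \<open>
  Two vectors with the same image under \<open>\<pi>\<close> differ by a multiple of \<open>e0\<close>.
\<close>

lemma proj_vimage_image:
  assumes "E.subspace V" "e0 \<in> V"
  shows "\<pi> -` (\<pi> ` V) = V"
proof
  show "\<pi> -` (\<pi> ` V) \<subseteq> V"
  proof
    fix x assume "x \<in> \<pi> -` (\<pi> ` V)"
    then obtain y where y: "y \<in> V" "\<pi> x = \<pi> y"
      by auto
    have "x = y + sE (\<eta> x - \<eta> y) e0"
      by (simp add: eq_iff_proj_height proj_arith height_arith proj_e0 height_e0 y)
    then show "x \<in> V"
      using y assms by (metis E.subspace_add E.subspace_scale)
  qed
qed auto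

lemma vimage_subspace:
  assumes "F.subspace U"
  shows "E.subspace (\<pi> -` U)" "e0 \<in> \<pi> -` U" "\<pi> ` (\<pi> -` U) = U"
  using assms surj_image_vimage_eq[OF proj_surj]
  by (auto simp: E.subspace_def F.subspace_def proj_arith proj_e0)

text \<open>
  Coordinates on a subspace through the kernel: those of its image under \<open>\<pi>\<close> and, in the last place,
  \<open>\<eta>\<close> for the line of \<open>e0\<close>.
\<close>

definition cone_coords :: "nat \<Rightarrow> (nat \<Rightarrow> 'f \<Rightarrow> complex) \<Rightarrow> nat \<Rightarrow> 'e \<Rightarrow> complex" where
  "cone_coords d l' j x = (if j < d then l' j (\<pi> x) else \<eta> x)"

lemma cone_coords_functional:
  assumes "\<And>j. j < d \<Longrightarrow> functional sF (l' j)"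
  shows "functional sE (cone_coords d l' j)"
  unfolding cone_coords_def using assms functional_proj height_functional by (cases "j < d") auto

text \<open>
  If \<open>u\<close> is the frame of \<open>U\<close>, then the \<open>\<iota> (u j)\<close> and \<open>e0\<close> form the frame of the preimage.
\<close>

lemma vimage_chart:
  assumes U: "U \<in> grass_chart sF d l'" and l': "\<And>j. j < d \<Longrightarrow> functional sF (l' j)"
  shows "\<pi> -` U \<in> grass_chart sE (Suc d) (cone_coords d l')"
proof -
  let ?u = "chart_frame d l' U"
  note frame = F.chart_frame[OF U l']
  have sub: "F.subspace U" and ker: "\<And>u. u \<in> U \<Longrightarrow> \<forall>j<d. l' j u = 0 \<Longrightarrow> u = 0"
    using U by (auto simp: grass_chart_def grass_def)
  show ?thesis
  proof (rule E.grass_chartI[where w = "\<lambda>j. if j < d then \<iota> (?u j) else e0"])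
    show "(if j < d then \<iota> (?u j) else e0) \<in> \<pi> -` U" if "j < Suc d" for j
      using frame vimage_subspace(2)[OF sub] by (simp add: proj_emb)
    show "cone_coords d l' i (if j < d then \<iota> (?u j) else e0) = (if i = j then 1 else 0)"
      if "i < Suc d" "j < Suc d" for i j
      using that frame by (auto simp: cone_coords_def proj_emb height_emb height_e0 proj_e0
          F.functional_arith(4)[OF l'] less_Suc_eq)
    show "v = 0" if "v \<in> \<pi> -` U" "\<forall>i<Suc d. cone_coords d l' i v = 0" for v
    proof -
      have "\<pi> v = 0"
        using that by (intro ker) (auto simp: cone_coords_def split: if_splits)
      moreover have "\<eta> v = 0"
        using that(2)[rule_format, of d] by (simp add: cone_coords_def)
      ultimately show ?thesis
        by (simp add: eq_iff_proj_height[of v 0] proj_arith height_arith)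
    qed
  qed (use vimage_subspace[OF sub] cone_coords_functional[OF l'] in auto)
qed

lemma vimage_grass:
  assumes "U \<in> grass sF d"
  shows "\<pi> -` U \<in> grass sE (Suc d)"
proof -
  obtain l' where "\<forall>i<d. functional sF (l' i)" "U \<in> grass_chart sF d l'"
    using F.grass_chart_exists[OF assms] by blast
  then show ?thesis
    using vimage_chart[of U d l'] by (auto simp: grass_chart_def)
qed

text \<open>
  \<open>V\<close> is the preimage of its image, and the dimension of a preimage is already known.
\<close>

lemma proj_grass_through_kernel:
  assumes "V \<in> grass sE (Suc d)" "e0 \<in> V"
  shows "\<pi> ` V \<in> grass sF d"
proof -
  have V: "E.subspace V" "E.dim V = Suc d"
    using assms by (auto simp: grass_def)
  have "\<pi> ` V \<in> grass sF (F.dim (\<pi> ` V))"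
    using subspace_proj[OF V(1)] by (simp add: grass_def)
  from vimage_grass[OF this] have "E.dim V = Suc (F.dim (\<pi> ` V))"
    using proj_vimage_image[OF V(1) assms(2)] by (simp add: grass_def)
  then show ?thesis
    using V subspace_proj[OF V(1)] by (simp add: grass_def)
qed

lemma proj_chart_through_kernel:
  assumes V: "V \<in> grass_chart sE (Suc d) (cone_coords d l')" and e0: "e0 \<in> V"
    and l': "\<And>j. j < d \<Longrightarrow> functional sF (l' j)"
  shows "\<pi> ` V \<in> grass_chart sF d l'"
    and "j < d \<Longrightarrow> chart_frame d l' (\<pi> ` V) j = \<pi> (chart_frame (Suc d) (cone_coords d l') V j)"
proof -
  let ?w = "chart_frame (Suc d) (cone_coords d l') V"
  note frame = E.chart_frame[OF V cone_coords_functional[OF l'], simplified]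
  have w: "\<pi> (?w j) \<in> \<pi> ` V" if "j < d" for j
    using frame(1)[of j] that by simp
  have dual: "l' i (\<pi> (?w j)) = (if i = j then 1 else 0)" if "i < d" "j < d" for i j
    using frame(2)[of j i] that by (simp add: cone_coords_def)
  show chart: "\<pi> ` V \<in> grass_chart sF d l'"
    using V e0 by (intro F.grass_chart_dualI[OF proj_grass_through_kernel l' w dual]) (auto simp: grass_chart_def)
  show "chart_frame d l' (\<pi> ` V) j = \<pi> (?w j)" if "j < d"
    using F.chart_frameI[OF chart l' w dual] that by simp
qed

subsection \<open>Subspaces off the kernel are graphs\<close>

definition graph :: "'f set \<Rightarrow> ('f \<Rightarrow> complex) \<Rightarrow> 'e set" where
  "graph U \<phi> = {x. \<pi> x \<in> U \<and> \<eta> x = \<phi> (\<pi> x)}"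

text \<open>
  The functional on \<open>\<pi> ` V\<close> whose graph is \<open>V\<close>; it is made extensional so that it belongs to \<open>dual_space\<close>.
\<close>

definition slope :: "'e set \<Rightarrow> 'f \<Rightarrow> complex" where
  "slope V = (\<lambda>u\<in>\<pi> ` V. \<eta> (inv_into V \<pi> u))"

text \<open>
  The kernel of \<open>\<pi>\<close> is the line of \<open>e0\<close>, which meets \<open>V\<close> only in \<open>0\<close>.
\<close>

lemma proj_inj_on:
  assumes "E.subspace V" "e0 \<notin> V"
  shows "inj_on \<pi> V"
proof (rule inj_onI)
  fix x y assume xy: "x \<in> V" "y \<in> V" "\<pi> x = \<pi> y"
  let ?c = "\<eta> (x - y)"
  have d: "x - y = sE ?c e0"
    using xy proj_eq_0_iff[of "x - y"] by (simp add: proj_arith)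
  have "?c = 0"
  proof (rule ccontr)
    assume "?c \<noteq> 0"
    then have "e0 = sE (1 / ?c) (sE ?c e0)"
      by simp
    also have "\<dots> = sE (1 / ?c) (x - y)"
      using d by simp
    also have "\<dots> \<in> V"
      using xy assms(1) by (intro E.subspace_scale E.subspace_diff)
    finally show False
      using assms(2) by simp
  qed
  then show "x = y"
    using d by simp
qed

lemma slope_proj:
  assumes "E.subspace V" "e0 \<notin> V" "x \<in> V"
  shows "slope V (\<pi> x) = \<eta> x"
  using assms inv_into_f_f[OF proj_inj_on[OF assms(1,2)]] by (simp add: slope_def)

lemma slope_dual:
  assumes "E.subspace V" "e0 \<notin> V"
  shows "slope V \<in> dual_space sF (\<pi> ` V)"
proof -
  have "slope V (\<pi> x + \<pi> y) = slope V (\<pi> x) + slope V (\<pi> y)" if "x \<in> V" "y \<in> V" for x y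
    using slope_proj[OF assms, of "x + y"] that E.subspace_add[OF assms(1) that]
    by (simp add: proj_arith height_arith slope_proj[OF assms])
  moreover have "slope V (sF c (\<pi> x)) = c * slope V (\<pi> x)" if "x \<in> V" for c x
    using slope_proj[OF assms, of "sE c x"] that E.subspace_scale[OF assms(1) that]
    by (simp add: proj_arith height_arith slope_proj[OF assms])
  ultimately show ?thesis
    by (auto simp: dual_space_def slope_def)
qed

lemma graph_slope:
  assumes "E.subspace V" "e0 \<notin> V"
  shows "graph (\<pi> ` V) (slope V) = V"
proof
  show "graph (\<pi> ` V) (slope V) \<subseteq> V"
  proof
    fix x assume "x \<in> graph (\<pi> ` V) (slope V)"
    then obtain y where y: "y \<in> V" "\<pi> x = \<pi> y" "\<eta> x = slope V (\<pi> y)"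
      by (auto simp: graph_def)
    then have "x = y"
      using slope_proj[OF assms y(1)] by (simp add: eq_iff_proj_height)
    then show "x \<in> V"
      using y by simp
  qed
qed (auto simp: graph_def slope_proj[OF assms])

lemma dual_arith:
  assumes "F.subspace U" "\<phi> \<in> dual_space sF U"
  shows "\<phi> 0 = 0" "u \<in> U \<Longrightarrow> v \<in> U \<Longrightarrow> \<phi> (u + v) = \<phi> u + \<phi> v" "u \<in> U \<Longrightarrow> \<phi> (sF c u) = c * \<phi> u"
proof -
  have "\<phi> (sF 0 0) = 0 * \<phi> 0"
    using assms F.subspace_0[OF assms(1)] unfolding dual_space_def by blast
  then show "\<phi> 0 = 0"
    by simp
qed (use assms in \<open>auto simp: dual_space_def\<close>)

lemma graph_subspace:
  assumes U: "F.subspace U" and \<phi>: "\<phi> \<in> dual_space sF U"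
  shows "E.subspace (graph U \<phi>)" "e0 \<notin> graph U \<phi>" "\<pi> ` graph U \<phi> = U" "slope (graph U \<phi>) = \<phi>"
    and "u \<in> U \<Longrightarrow> \<iota> u + sE (\<phi> u) e0 \<in> graph U \<phi>"
proof -
  note [simp] = proj_arith height_arith proj_e0 height_e0 proj_emb height_emb dual_arith[OF assms]
  show sub: "E.subspace (graph U \<phi>)"
    using U by (auto simp: E.subspace_def F.subspace_def graph_def)
  show e0: "e0 \<notin> graph U \<phi>"
    by (simp add: graph_def)
  show emb: "\<iota> u + sE (\<phi> u) e0 \<in> graph U \<phi>" if "u \<in> U" for u
    using that by (simp add: graph_def)
  show im: "\<pi> ` graph U \<phi> = U"
  proof
    show "U \<subseteq> \<pi> ` graph U \<phi>"
    proof
      fix u assume "u \<in> U"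
      then have "\<pi> (\<iota> u + sE (\<phi> u) e0) \<in> \<pi> ` graph U \<phi>"
        by (intro imageI emb)
      then show "u \<in> \<pi> ` graph U \<phi>"
        by simp
    qed
  qed (auto simp: graph_def)
  show "slope (graph U \<phi>) = \<phi>"
  proof
    fix u
    show "slope (graph U \<phi>) u = \<phi> u"
    proof (cases "u \<in> U")
      case True
      then show ?thesis
        using slope_proj[OF sub e0 emb[OF True]] by simp
    next
      case False
      then show ?thesis
        using \<phi> by (simp add: slope_def im dual_space_def extensional_def)
    qed
  qed
qed

text \<open>
  The frame \<open>u\<close> of \<open>U\<close> lifts to the frame \<open>\<iota> (u j) + \<phi> (u j) \<cdot> e0\<close> of the graph.
\<close>

lemma graph_chart:
  assumes U: "U \<in> grass_chart sF d l'" and l': "\<And>j. j < d \<Longrightarrow> functional sF (l' j)"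
    and \<phi>: "\<phi> \<in> dual_space sF U"
  shows "graph U \<phi> \<in> grass_chart sE d (\<lambda>j x. l' j (\<pi> x))"
proof -
  let ?u = "chart_frame d l' U"
  note frame = F.chart_frame[OF U l']
  have sub: "F.subspace U" and ker: "\<And>u. u \<in> U \<Longrightarrow> \<forall>j<d. l' j u = 0 \<Longrightarrow> u = 0"
    using U by (auto simp: grass_chart_def grass_def)
  show ?thesis
  proof (rule E.grass_chartI[where w = "\<lambda>j. \<iota> (?u j) + sE (\<phi> (?u j)) e0"])
    show "l' i (\<pi> (\<iota> (?u j) + sE (\<phi> (?u j)) e0)) = (if i = j then 1 else 0)" if "i < d" "j < d" for i j
      using that frame by (simp add: proj_arith proj_emb proj_e0)
    show "v = 0" if "v \<in> graph U \<phi>" "\<forall>i<d. l' i (\<pi> v) = 0" for v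
    proof -
      have "\<pi> v = 0"
        using that by (intro ker) (auto simp: graph_def)
      moreover from this have "\<eta> v = 0"
        using that(1) dual_arith[OF sub \<phi>] by (simp add: graph_def)
      ultimately show ?thesis
        by (simp add: eq_iff_proj_height[of v 0] proj_arith height_arith)
    qed
  qed (use graph_subspace[OF sub \<phi>] frame functional_proj[OF l'] in auto)
qed

lemma graph_grass:
  assumes "U \<in> grass sF d" "\<phi> \<in> dual_space sF U"
  shows "graph U \<phi> \<in> grass sE d"
proof -
  obtain l' where "\<forall>i<d. functional sF (l' i)" "U \<in> grass_chart sF d l'"
    using F.grass_chart_exists[OF assms(1)] by blast
  then show ?thesis
    using graph_chart[of U d l', OF _ _ assms(2)] by (auto simp: grass_chart_def)
qed

lemma proj_grass_off_kernel:
  assumes "V \<in> grass sE d" "e0 \<notin> V"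
  shows "\<pi> ` V \<in> grass sF d"
proof -
  have V: "E.subspace V" "E.dim V = d"
    using assms by (auto simp: grass_def)
  have "\<pi> ` V \<in> grass sF (F.dim (\<pi> ` V))"
    using subspace_proj[OF V(1)] by (simp add: grass_def)
  from graph_grass[OF this slope_dual[OF V(1) assms(2)]] have "E.dim V = F.dim (\<pi> ` V)"
    using graph_slope[OF V(1) assms(2)] by (simp add: grass_def)
  then show ?thesis
    using V subspace_proj[OF V(1)] by (simp add: grass_def)
qed

text \<open>
  Functionals pulled back along \<open>\<pi>\<close> all vanish at \<open>e0\<close>, so their chart contains only subspaces off the
  kernel, and \<open>\<pi>\<close> maps frames to frames.
\<close>

lemma proj_chart_off_kernel:
  assumes V: "V \<in> grass_chart sE d (\<lambda>j x. l' j (\<pi> x))"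
    and l': "\<And>j. j < d \<Longrightarrow> functional sF (l' j)"
  shows "e0 \<notin> V" and "\<pi> ` V \<in> grass_chart sF d l'"
    and "j < d \<Longrightarrow> chart_frame d l' (\<pi> ` V) j = \<pi> (chart_frame d (\<lambda>j x. l' j (\<pi> x)) V j)"
proof -
  let ?w = "chart_frame d (\<lambda>j x. l' j (\<pi> x)) V"
  note frame = E.chart_frame[OF V functional_proj[OF l'], simplified]
  have "\<forall>j<d. l' j (\<pi> e0) = 0"
    by (simp add: proj_e0 F.functional_arith(4)[OF l'])
  then show e0: "e0 \<notin> V"
    using V e0_nonzero by (auto simp: grass_chart_def)
  have w: "\<pi> (?w j) \<in> \<pi> ` V" if "j < d" for j
    using frame(1)[of j] that by simp
  have dual: "l' i (\<pi> (?w j)) = (if i = j then 1 else 0)" if "i < d" "j < d" for i j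
    using frame(2)[of j i] that by simp
  show chart: "\<pi> ` V \<in> grass_chart sF d l'"
    using V e0 by (intro F.grass_chart_dualI[OF proj_grass_off_kernel l' w dual]) (auto simp: grass_chart_def)
  show "chart_frame d l' (\<pi> ` V) j = \<pi> (?w j)" if "j < d"
    using F.chart_frameI[OF chart l' w dual] that by simp
qed

subsection \<open>Isotropy\<close>

lemma vimage_isotropic:
  "U \<in> isotropic_grass sF \<sigma> d \<Longrightarrow> \<pi> -` U \<in> isotropic_grass sE \<omega> (Suc d) \<and> e0 \<in> \<pi> -` U \<and> \<pi> ` (\<pi> -` U) = U"
  using vimage_grass[of U d] vimage_subspace[of U] by (auto simp: isotropic_grass_def grass_def form_proj)

lemma proj_isotropic_through_kernel:
  "V \<in> isotropic_grass sE \<omega> (Suc d) \<Longrightarrow> e0 \<in> V \<Longrightarrow> \<pi> ` V \<in> isotropic_grass sF \<sigma> d"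
  using proj_grass_through_kernel[of V d] by (auto simp: isotropic_grass_def form_proj)

lemma graph_isotropic:
  "U \<in> isotropic_grass sF \<sigma> d \<Longrightarrow> \<phi> \<in> dual_space sF U \<Longrightarrow> graph U \<phi> \<in> isotropic_grass sE \<omega> d"
  using graph_grass[of U d \<phi>] by (auto simp: isotropic_grass_def form_proj graph_def)

lemma proj_isotropic_off_kernel:
  "V \<in> isotropic_grass sE \<omega> d \<Longrightarrow> e0 \<notin> V \<Longrightarrow> \<pi> ` V \<in> isotropic_grass sF \<sigma> d"
  using proj_grass_off_kernel[of V d] by (auto simp: isotropic_grass_def form_proj)

text \<open>
  In the frame \<open>w\<close> of a chart around \<open>U\<close>, the functional \<open>\<Sum>j. l j u * \<phi> (w j)\<close> is defined on all of \<open>F\<close>.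
\<close>

lemma dual_extends:
  assumes U: "U \<in> grass sF d" and \<phi>: "\<phi> \<in> dual_space sF U"
  shows "\<exists>\<mu>. functional sF \<mu> \<and> (\<forall>u\<in>U. \<mu> u = \<phi> u)"
proof -
  obtain l where l: "\<And>i. i < d \<Longrightarrow> functional sF (l i)" and chart: "U \<in> grass_chart sF d l"
    using F.grass_chart_exists[OF U] by blast
  have sub: "F.subspace U"
    using U by (simp add: grass_def)
  define w where "w = chart_frame d l U"
  note frame = F.chart_frame[OF chart l, folded w_def]
  define \<mu> where "\<mu> u = (\<Sum>j<d. l j u * \<phi> (w j))" for u
  have "functional sF \<mu>"
  proof (rule F.functionalI)
    show "\<mu> (u + v) = \<mu> u + \<mu> v" for u v
      unfolding \<mu>_def sum.distrib[symmetric]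
      by (rule sum.cong) (simp_all add: F.functional_arith(1)[OF l] distrib_right)
    show "\<mu> (sF c u) = c * \<mu> u" for c u
      unfolding \<mu>_def sum_distrib_left by (rule sum.cong) (simp_all add: F.functional_arith(5)[OF l])
  qed
  moreover have "\<mu> u = \<phi> u" if "u \<in> U" for u
  proof -
    have sums: "(\<Sum>j\<in>J. sF (c j) (w j)) \<in> U \<and> \<phi> (\<Sum>j\<in>J. sF (c j) (w j)) = (\<Sum>j\<in>J. c j * \<phi> (w j))"
      if "finite J" "J \<subseteq> {..<d}" for c J
      using that
    proof (induction J)
      case empty
      then show ?case
        using F.subspace_0[OF sub] dual_arith(1)[OF sub \<phi>] by simp
    next
      case (insert j J)
      then have "sF (c j) (w j) \<in> U" "w j \<in> U"
        using frame(1) F.subspace_scale[OF sub] by auto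
      then show ?case
        using insert F.subspace_add[OF sub] by (simp add: dual_arith[OF sub \<phi>])
    qed
    show ?thesis
      using sums[of "{..<d}" "\<lambda>j. l j u"] F.chart_frame_expand[OF chart l that]
      by (simp add: \<mu>_def w_def)
  qed
  ultimately show ?thesis
    by blast
qed

end

section \<open>The two strata as varieties\<close>

context odd_splitting
begin

definition through_kernel :: "nat \<Rightarrow> 'e set set" where
  "through_kernel k = {V \<in> isotropic_grass sE \<omega> k. e0 \<in> V}"

definition off_kernel :: "nat \<Rightarrow> 'e set set" where
  "off_kernel k = {V \<in> isotropic_grass sE \<omega> k. e0 \<notin> V}"

text \<open>
  The charts given by functionals that factor through \<open>\<pi>\<close> lie in this set and cover it.
\<close>

lemma openin_off_kernel: "openin (zariski (isotropic_grass_variety sE \<omega> k)) (off_kernel k)"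
proof (subst openin_subopen, intro ballI)
  fix V assume V: "V \<in> off_kernel k"
  then have "\<pi> ` V \<in> isotropic_grass sF \<sigma> k"
    by (auto simp: off_kernel_def intro: proj_isotropic_off_kernel)
  then obtain l where l: "\<And>i. i < k \<Longrightarrow> functional sF (l i)" "\<pi> ` V \<in> grass_chart sF k l"
    using F.isotropic_in_chart by blast
  let ?D = "grass_chart sE k (\<lambda>j x. l j (\<pi> x)) \<inter> isotropic_grass sE \<omega> k"
  have sub: "E.subspace V" "e0 \<notin> V"
    using V by (auto simp: off_kernel_def isotropic_grass_def grass_def)
  have "V \<in> ?D"
    using graph_chart[OF l(2,1) slope_dual[OF sub]] graph_slope[OF sub] V by (auto simp: off_kernel_def)
  moreover have "openin (zariski (isotropic_grass_variety sE \<omega> k)) ?D"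
    using functional_proj[OF l(1)]
    by (intro openin_zariski_chart[where L = "frame_coords sE k (\<lambda>j x. l j (\<pi> x))"])
      (auto simp: isotropic_grass_variety_eq)
  moreover have "?D \<subseteq> off_kernel k"
    using proj_chart_off_kernel(1)[OF _ l(1)] by (auto simp: off_kernel_def)
  ultimately show "\<exists>T. openin (zariski (isotropic_grass_variety sE \<omega> k)) T \<and> V \<in> T \<and> T \<subseteq> off_kernel k"
    by blast
qed

lemma closedin_through_kernel: "closedin (zariski (isotropic_grass_variety sE \<omega> k)) (through_kernel k)"
proof -
  have "topspace (zariski (isotropic_grass_variety sE \<omega> k)) - through_kernel k = off_kernel k"
    by (auto simp: E.topspace_isotropic_variety through_kernel_def off_kernel_def)
  then show ?thesis
    using openin_off_kernel[of k]
    by (auto simp: closedin_def E.topspace_isotropic_variety through_kernel_def)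
qed

lemma proj_morphism:
  "variety_morphism (subvariety (isotropic_grass_variety sE \<omega> (Suc d)) (through_kernel (Suc d)))
     (isotropic_grass_variety sF \<sigma> d) (image \<pi>)"
proof (rule variety_morphism_polyI)
  fix V assume "V \<in> topspace (zariski (subvariety (isotropic_grass_variety sE \<omega> (Suc d)) (through_kernel (Suc d))))"
  then have V: "V \<in> isotropic_grass sE \<omega> (Suc d)" "e0 \<in> V"
    by (auto simp: E.topspace_isotropic_subvariety through_kernel_def)
  then show "\<pi> ` V \<in> topspace (zariski (isotropic_grass_variety sF \<sigma> d))"
    by (simp add: F.topspace_isotropic_variety proj_isotropic_through_kernel)
  fix D' L' assume "(D', L') \<in> isotropic_grass_variety sF \<sigma> d" and D': "\<pi> ` V \<in> D'"
  then obtain l where l: "\<And>i. i < d \<Longrightarrow> functional sF (l i)"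
    and eq: "D' = grass_chart sF d l \<inter> isotropic_grass sF \<sigma> d" "L' = frame_coords sF d l"
    by (auto simp: isotropic_grass_variety_eq)
  let ?l = "cone_coords d l"
  let ?D = "grass_chart sE (Suc d) ?l \<inter> isotropic_grass sE \<omega> (Suc d) \<inter> through_kernel (Suc d)"
  have "V \<in> ?D"
    using vimage_chart[of "\<pi> ` V" d l] l D' V proj_vimage_image[of V]
    by (auto simp: eq through_kernel_def isotropic_grass_def grass_def)
  moreover have "(?D, frame_coords sE (Suc d) ?l) \<in>
      subvariety (isotropic_grass_variety sE \<omega> (Suc d)) (through_kernel (Suc d))"
    using cone_coords_functional[OF l] by (auto simp: isotropic_subvariety_eq)
  moreover have "\<forall>W\<in>?D. \<pi> ` W \<in> D'"
    using proj_chart_through_kernel(1)[OF _ _ l] proj_isotropic_through_kernel by (auto simp: eq through_kernel_def)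
  moreover have "\<forall>p\<in>L'. \<exists>r\<in>polys (frame_coords sE (Suc d) ?l). \<forall>W\<in>?D. p (\<pi> ` W) = r W"
  proof
    fix p assume "p \<in> L'"
    then obtain m j where p: "functional sF m" "j < d" "p = (\<lambda>U. m (chart_frame d l U j))"
      by (auto simp: eq frame_coords_def)
    have "(\<lambda>W. m (\<pi> (chart_frame (Suc d) ?l W j))) \<in> polys (frame_coords sE (Suc d) ?l)"
      using p by (intro frame_coord_poly functional_proj) auto
    moreover have "\<forall>W\<in>?D. p (\<pi> ` W) = m (\<pi> (chart_frame (Suc d) ?l W j))"
      using p(2) proj_chart_through_kernel(2)[OF _ _ l] by (auto simp: p(3) through_kernel_def)
    ultimately show "\<exists>r\<in>polys (frame_coords sE (Suc d) ?l). \<forall>W\<in>?D. p (\<pi> ` W) = r W"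
      by - (rule rev_bexI)
  qed
  ultimately show "\<exists>D L. (D, L) \<in> subvariety (isotropic_grass_variety sE \<omega> (Suc d)) (through_kernel (Suc d)) \<and>
      V \<in> D \<and> (\<forall>W\<in>D. \<pi> ` W \<in> D') \<and> (\<forall>p\<in>L'. \<exists>r\<in>polys L. \<forall>W\<in>D. p (\<pi> ` W) = r W)"
    by (intro exI conjI)
qed

lemma graph_proj_morphism:
  "variety_morphism (subvariety (isotropic_grass_variety sE \<omega> k) (off_kernel k))
     (dual_taut_variety sF \<sigma> k) (\<lambda>V. (\<pi> ` V, slope V))"
proof (rule variety_morphism_polyI)
  fix V assume "V \<in> topspace (zariski (subvariety (isotropic_grass_variety sE \<omega> k) (off_kernel k)))"
  then have V: "V \<in> isotropic_grass sE \<omega> k" "e0 \<notin> V"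
    by (auto simp: E.topspace_isotropic_subvariety off_kernel_def)
  then have sub: "E.subspace V"
    by (simp add: isotropic_grass_def grass_def)
  show "(\<pi> ` V, slope V) \<in> topspace (zariski (dual_taut_variety sF \<sigma> k))"
    using V by (simp add: F.topspace_dual_taut_variety proj_isotropic_off_kernel slope_dual[OF sub])
  fix D' L' assume "(D', L') \<in> dual_taut_variety sF \<sigma> k" and D': "(\<pi> ` V, slope V) \<in> D'"
  then obtain l where l: "\<And>i. i < k \<Longrightarrow> functional sF (l i)"
    and eq: "D' = Sigma (grass_chart sF k l \<inter> isotropic_grass sF \<sigma> k) (dual_space sF)"
      "L' = dual_coords sF k l"
    by (auto simp: dual_taut_variety_eq)
  let ?l = "\<lambda>j x. l j (\<pi> x)"
  let ?D = "grass_chart sE k ?l \<inter> isotropic_grass sE \<omega> k \<inter> off_kernel k"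
  have "V \<in> ?D"
    using graph_chart[of "\<pi> ` V" k l "slope V"] l D' V graph_slope[OF sub V(2)]
    by (auto simp: eq off_kernel_def)
  moreover have "(?D, frame_coords sE k ?l) \<in>
      subvariety (isotropic_grass_variety sE \<omega> k) (off_kernel k)"
    using functional_proj[OF l] by (auto simp: isotropic_subvariety_eq)
  moreover have "\<forall>W\<in>?D. (\<pi> ` W, slope W) \<in> D'"
    using proj_chart_off_kernel(2)[OF _ l] proj_isotropic_off_kernel slope_dual
    by (auto simp: eq off_kernel_def isotropic_grass_def grass_def)
  moreover have "\<forall>p\<in>L'. \<exists>r\<in>polys (frame_coords sE k ?l). \<forall>W\<in>?D. p (\<pi> ` W, slope W) = r W"
  proof
    fix p assume "p \<in> L'"
    then have "p \<in> dual_coords sF k l"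
      by (simp add: eq)
    then show "\<exists>r\<in>polys (frame_coords sE k ?l). \<forall>W\<in>?D. p (\<pi> ` W, slope W) = r W"
    proof (cases rule: dual_coords_cases)
      case (1 m j)
      have "(\<lambda>W. m (\<pi> (chart_frame k ?l W j))) \<in> polys (frame_coords sE k ?l)"
        using 1 by (intro frame_coord_poly functional_proj) auto
      moreover have "\<forall>W\<in>?D. p (\<pi> ` W, slope W) = m (\<pi> (chart_frame k ?l W j))"
        using 1 proj_chart_off_kernel(3)[OF _ l] by auto
      ultimately show ?thesis
        by - (rule rev_bexI)
    next
      case (2 j)
      have "(\<lambda>W. \<eta> (chart_frame k ?l W j)) \<in> polys (frame_coords sE k ?l)"
        using 2 by (intro frame_coord_poly height_functional) auto
      moreover have "p (\<pi> ` W, slope W) = \<eta> (chart_frame k ?l W j)" if W: "W \<in> ?D" for W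
      proof -
        have W: "W \<in> grass_chart sE k ?l" "E.subspace W" "e0 \<notin> W"
          using that by (auto simp: off_kernel_def isotropic_grass_def grass_def)
        then show ?thesis
          using 2 proj_chart_off_kernel(3)[OF W(1) l 2(1)] E.chart_frame(1)[OF W(1) functional_proj[OF l] 2(1)]
          by (simp add: slope_proj)
      qed
      ultimately show ?thesis
        by (intro rev_bexI ballI)
    qed
  qed
  ultimately show "\<exists>D L. (D, L) \<in> subvariety (isotropic_grass_variety sE \<omega> k) (off_kernel k) \<and>
      V \<in> D \<and> (\<forall>W\<in>D. (\<pi> ` W, slope W) \<in> D') \<and>
      (\<forall>p\<in>L'. \<exists>r\<in>polys L. \<forall>W\<in>D. p (\<pi> ` W, slope W) = r W)"
    by (intro exI conjI)
qed

text \<open>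
  Some functional \<open>l i0\<close> of a chart around the preimage of \<open>U\<close> is nonzero at \<open>e0\<close>. Subtracting multiples of it
  makes the other \<open>d\<close> functionals vanish at \<open>e0\<close>, so that they come from functionals on \<open>F\<close>; these give
  the chart around \<open>U\<close>. Conversely each frame vector of a subspace \<open>W\<close> in that chart is lifted to the
  vector over it on which \<open>l i0\<close> vanishes, and a multiple of \<open>e0\<close> corrected by these lifts is the
  remaining vector of the frame of the preimage of \<open>W\<close>. All this is polynomial in the frame of \<open>W\<close>.
\<close>

lemma vimage_morphism:
  "variety_morphism (isotropic_grass_variety sF \<sigma> d)
     (subvariety (isotropic_grass_variety sE \<omega> (Suc d)) (through_kernel (Suc d))) (vimage \<pi>)"
proof (rule variety_morphism_polyI)
  fix U assume "U \<in> topspace (zariski (isotropic_grass_variety sF \<sigma> d))"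
  then have U: "U \<in> isotropic_grass sF \<sigma> d"
    by (simp add: F.topspace_isotropic_variety)
  then show "\<pi> -` U \<in> topspace (zariski (subvariety (isotropic_grass_variety sE \<omega> (Suc d)) (through_kernel (Suc d))))"
    using vimage_isotropic[OF U] by (simp add: E.topspace_isotropic_subvariety through_kernel_def)
  fix D' L' assume "(D', L') \<in> subvariety (isotropic_grass_variety sE \<omega> (Suc d)) (through_kernel (Suc d))"
    and "\<pi> -` U \<in> D'"
  then obtain l where l: "\<And>i. i < Suc d \<Longrightarrow> functional sE (l i)"
    and eq: "D' = grass_chart sE (Suc d) l \<inter> isotropic_grass sE \<omega> (Suc d) \<inter> through_kernel (Suc d)"
      "L' = frame_coords sE (Suc d) l"
    and VU: "\<pi> -` U \<in> grass_chart sE (Suc d) l"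
    by (auto simp: isotropic_subvariety_eq)
  note l_arith = E.functional_arith[OF l]
  have "e0 \<in> \<pi> -` U"
    using vimage_isotropic[OF U] by blast
  then obtain i0 where i0: "i0 < Suc d" "l i0 e0 \<noteq> 0"
    using VU e0_nonzero by (auto simp: grass_chart_def)
  \<comment> \<open>The indices other than \<open>i0\<close> are renumbered by \<open>{..<d}\<close>.\<close>
  have "card {..<d} = card ({..<Suc d} - {i0})"
    using i0(1) by simp
  then obtain \<tau> where \<tau>: "bij_betw \<tau> {..<d} ({..<Suc d} - {i0})"
    using bij_betw_iff_card[of "{..<d}" "{..<Suc d} - {i0}"] by auto
  have \<tau>1: "\<tau> i < Suc d" "\<tau> i \<noteq> i0" if "i < d" for i
    using bij_betwE[OF \<tau>] that by auto
  have \<tau>2: "\<exists>i<d. j = \<tau> i" if "j < Suc d" "j \<noteq> i0" for j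
    using bij_betw_imp_surj_on[OF \<tau>] that by (auto simp: image_iff dest!: equalityD2 subsetD[of _ _ j])
  have \<tau>3: "\<tau> i = \<tau> j \<longleftrightarrow> i = j" if "i < d" "j < d" for i j
    using inj_on_eq_iff[OF bij_betw_imp_inj_on[OF \<tau>]] that by simp
  define c where "c j = l j e0 / l i0 e0" for j
  define l' where "l' i u = l (\<tau> i) (\<iota> u) - c (\<tau> i) * l i0 (\<iota> u)" for i u
  have l': "functional sF (l' i)" if "i < d" for i
    using that \<tau>1 i0(1)
    by (intro F.functionalI) (simp_all add: l'_def emb_arith l_arith algebra_simps)
  have l'_proj: "l' i (\<pi> x) = l (\<tau> i) x - c (\<tau> i) * l i0 x" if "i < d" for i x
    using that \<tau>1 i0 by (simp add: l'_def emb_proj l_arith c_def field_simps)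
  let ?D = "grass_chart sF d l' \<inter> isotropic_grass sF \<sigma> d"
  have "U \<in> grass_chart sF d l'"
    unfolding grass_chart_def
  proof (intro CollectI conjI ballI impI)
    fix u assume u: "u \<in> U" "\<forall>i<d. l' i u = 0"
    \<comment> \<open>The lift of \<open>u\<close> on which \<open>l i0\<close> vanishes.\<close>
    let ?x = "\<iota> u - sE (l i0 (\<iota> u) / l i0 e0) e0"
    have px: "\<pi> ?x = u"
      by (simp add: proj_arith proj_emb proj_e0)
    have l0: "l i0 ?x = 0"
      using i0 by (simp add: l_arith)
    have "l j ?x = 0" if j: "j < Suc d" for j
    proof (cases "j = i0")
      case False
      then obtain i where "i < d" "j = \<tau> i"
        using \<tau>2[OF j False] by blast
      then show ?thesis
        using l'_proj[of i ?x] u(2) unfolding px l0 by simp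
    qed (simp add: l0)
    moreover have "?x \<in> \<pi> -` U"
      using u(1) px by simp
    ultimately have "?x = 0"
      using VU unfolding grass_chart_def by blast
    then show "u = 0"
      using px proj_arith(4) by simp
  qed (use U in \<open>simp add: isotropic_grass_def\<close>)
  then have "U \<in> ?D"
    using U by simp
  moreover have "(?D, frame_coords sF d l') \<in> isotropic_grass_variety sF \<sigma> d"
    using l' by (auto simp: isotropic_grass_variety_eq)
  moreover have chart: "\<pi> -` W \<in> grass_chart sE (Suc d) l" if W: "W \<in> grass_chart sF d l'" for W
    unfolding grass_chart_def
  proof (intro CollectI conjI ballI impI)
    show "\<pi> -` W \<in> grass sE (Suc d)"
      using W by (intro vimage_grass) (simp add: grass_chart_def)
    fix x assume x: "x \<in> \<pi> -` W" "\<forall>i<Suc d. l i x = 0"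
    have "\<forall>i<d. l' i (\<pi> x) = 0"
      using x(2) \<tau>1 i0(1) by (simp add: l'_proj)
    then have "\<pi> x = 0"
      using W x(1) by (auto simp: grass_chart_def)
    then have x_eq: "x = sE (\<eta> x) e0"
      by (simp add: proj_eq_0_iff)
    then have "\<eta> x * l i0 e0 = 0"
      using x(2) i0(1) l_arith(5)[OF i0(1), of "\<eta> x" e0] by simp
    then show "x = 0"
      using i0(2) x_eq by simp
  qed
  moreover have "\<forall>W\<in>?D. \<pi> -` W \<in> D'"
    using chart vimage_isotropic by (auto simp: eq through_kernel_def)
  moreover have "\<forall>p\<in>L'. \<exists>r\<in>polys (frame_coords sF d l'). \<forall>W\<in>?D. p (\<pi> -` W) = r W"
  proof
    fix p assume "p \<in> L'"
    then obtain m j where m: "functional sE m" and j: "j < Suc d"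
      and p: "p = (\<lambda>V. m (chart_frame (Suc d) l V j))"
      by (auto simp: eq frame_coords_def)
    define w where "w W i = \<iota> (chart_frame d l' W i) - sE (l i0 (\<iota> (chart_frame d l' W i)) / l i0 e0) e0"
      for W i
    have w_proj: "\<pi> (w W i) = chart_frame d l' W i" for W i
      by (simp add: w_def proj_arith proj_emb proj_e0)
    have w0: "l i0 (w W i) = 0" for W i
      using i0 by (simp add: w_def l_arith)
    have w1: "l (\<tau> i') (w W i) = (if i' = i then 1 else 0)"
      if "W \<in> grass_chart sF d l'" "i < d" "i' < d" for W i i'
      using l'_proj[OF that(3), of "w W i"] F.chart_frame(2)[OF that(1) l' that(2,3)]
      by (simp add: w0 w_proj)
    have w_mem: "w W i \<in> \<pi> -` W" if "W \<in> grass_chart sF d l'" "i < d" for W i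
      using F.chart_frame(1)[OF that(1) l' that(2)] by (simp add: w_proj)
    have m_w: "(\<lambda>W. m (w W i)) \<in> polys (frame_coords sF d l')" if "i < d" for i
    proof -
      have "(\<lambda>W. m (\<iota> (chart_frame d l' W i)) - m e0 / l i0 e0 * l i0 (\<iota> (chart_frame d l' W i)))
          \<in> polys (frame_coords sF d l')"
        using m l[OF i0(1)] that
        by (intro polys_diff polys_scale frame_coord_poly[where m = "\<lambda>u. _ (\<iota> u)"] functional_emb)
      then show ?thesis
        by (simp add: w_def E.functional_arith[OF m] mult.commute)
    qed
    show "\<exists>r\<in>polys (frame_coords sF d l'). \<forall>W\<in>?D. p (\<pi> -` W) = r W"
    proof (cases "j = i0")
      case False
      then obtain i where i: "i < d" "j = \<tau> i"
        using \<tau>2[OF j False] by blast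
      have "chart_frame (Suc d) l (\<pi> -` W) j = w W i" if W: "W \<in> grass_chart sF d l'" for W
      proof (rule E.chart_frameI[OF chart[OF W] l w_mem[OF W i(1)]])
        fix i' assume "i' < Suc d"
        then show "l i' (w W i) = (if i' = j then 1 else 0)"
          using \<tau>2[of i'] w0 w1[OF W i(1)] \<tau>3[OF _ i(1)] False i by (cases "i' = i0") auto
      qed
      then show ?thesis
        using m_w[OF i(1)] by (intro rev_bexI[OF m_w[OF i(1)]]) (simp add: p)
    next
      case True
      \<comment> \<open>The multiple of \<open>e0\<close> with value \<open>1\<close> under \<open>l i0\<close>, corrected to vanish under the other functionals.\<close>
      define v where "v W = sE (1 / l i0 e0) e0 - (\<Sum>i<d. sE (c (\<tau> i)) (w W i))" for W
      have m_v: "m' (v W) = m' e0 / l i0 e0 - (\<Sum>i<d. c (\<tau> i) * m' (w W i))" if "functional sE m'" for m' W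
        using E.functional_sum_expand[OF that, of "\<lambda>i. c (\<tau> i)" "w W" "{..<d}"]
        by (simp add: v_def E.functional_arith[OF that])
      have "chart_frame (Suc d) l (\<pi> -` W) j = v W" if W: "W \<in> grass_chart sF d l'" for W
      proof (rule E.chart_frameI[OF chart[OF W] l])
        have "F.subspace W"
          using W by (simp add: grass_chart_def grass_def)
        from vimage_subspace(1,2)[OF this] show "v W \<in> \<pi> -` W"
          unfolding v_def
          by (intro E.subspace_diff E.subspace_sum E.subspace_scale w_mem[OF W]) auto
        fix i' assume i': "i' < Suc d"
        show "l i' (v W) = (if i' = j then 1 else 0)"
        proof (cases "i' = i0")
          case True
          then show ?thesis
            using \<open>j = i0\<close> i0 by (simp add: m_v[OF l[OF i0(1)]] w0)
        next
          case False
          then obtain i where i: "i < d" "i' = \<tau> i"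
            using \<tau>2[OF i' False] by blast
          have "(\<Sum>i''<d. c (\<tau> i'') * l i' (w W i'')) = (\<Sum>i''<d. if i = i'' then c (\<tau> i'') else 0)"
            using w1[OF W _ i(1)] i(2) by (intro sum.cong) auto
          also have "\<dots> = c i'"
            using i by simp
          finally have "l i' (v W) = l i' e0 / l i0 e0 - c i'"
            by (simp only: m_v[OF l[OF i']])
          then show ?thesis
            using False \<open>j = i0\<close> by (simp add: c_def)
        qed
      qed
      moreover have "(\<lambda>W. m (v W)) \<in> polys (frame_coords sF d l')"
        unfolding m_v[OF m] using m_w by (intro polys_diff polys_sum polys_scale polys.const) auto
      ultimately show ?thesis
        by (intro rev_bexI[where x = "\<lambda>W. m (v W)"]) (simp_all add: p)
    qed
  qed
  ultimately show "\<exists>D L. (D, L) \<in> isotropic_grass_variety sF \<sigma> d \<and>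
      U \<in> D \<and> (\<forall>W\<in>D. \<pi> -` W \<in> D') \<and> (\<forall>p\<in>L'. \<exists>r\<in>polys L. \<forall>W\<in>D. p (\<pi> -` W) = r W)"
    by (intro exI conjI)
qed

text \<open>
  Let \<open>\<mu>\<close> be a functional on \<open>F\<close> that extends \<open>\<phi>\<close>, and let \<open>c i = l i e0\<close>. The restriction of \<open>l\<close> to the
  graph of \<open>\<mu>\<close> gives a chart around \<open>U\<close>. If \<open>(W, \<psi>)\<close> lies over this chart, with frame \<open>u\<close> of \<open>W\<close>, then the
  vectors \<open>v j = \<iota> (u j) + \<psi> (u j) \<cdot> e0\<close> form a basis of the graph of \<open>\<psi>\<close>, and
  \<open>l i (v j) = (if i = j then 1 else 0) + c i * \<delta> j\<close> with \<open>\<delta> j = \<psi> (u j) - \<mu> (u j)\<close>. This matrix is a rank one perturbation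
  of the identity. Its determinant is \<open>q = 1 + \<Sum>i. c i * \<delta> i\<close>, which is \<open>1\<close> at \<open>(U, \<phi>)\<close>, and by the
  Sherman-Morrison formula its inverse is polynomial up to the denominator \<open>q\<close>.
\<close>

lemma graph_morphism:
  "variety_morphism (dual_taut_variety sF \<sigma> k)
     (subvariety (isotropic_grass_variety sE \<omega> k) (off_kernel k)) (\<lambda>(U, \<phi>). graph U \<phi>)"
proof (rule variety_morphismI)
  fix x assume "x \<in> topspace (zariski (dual_taut_variety sF \<sigma> k))"
  then obtain U \<phi> where x: "x = (U, \<phi>)" and U: "U \<in> isotropic_grass sF \<sigma> k" and \<phi>: "\<phi> \<in> dual_space sF U"
    by (auto simp: F.topspace_dual_taut_variety)
  have sub: "F.subspace U" and gr: "U \<in> grass sF k"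
    using U by (auto simp: isotropic_grass_def grass_def)
  show "(case x of (U, \<phi>) \<Rightarrow> graph U \<phi>)
      \<in> topspace (zariski (subvariety (isotropic_grass_variety sE \<omega> k) (off_kernel k)))"
    using graph_isotropic[OF U \<phi>] graph_subspace(2)[OF sub \<phi>]
    by (simp add: E.topspace_isotropic_subvariety off_kernel_def x)
  fix D' L' assume "(D', L') \<in> subvariety (isotropic_grass_variety sE \<omega> k) (off_kernel k)"
    and "(case x of (U, \<phi>) \<Rightarrow> graph U \<phi>) \<in> D'"
  then obtain l where l: "\<And>i. i < k \<Longrightarrow> functional sE (l i)"
    and eq: "D' = grass_chart sE k l \<inter> isotropic_grass sE \<omega> k \<inter> off_kernel k"
      "L' = frame_coords sE k l"
    and G: "graph U \<phi> \<in> grass_chart sE k l"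
    by (auto simp: isotropic_subvariety_eq x)
  note l_arith = E.functional_arith[OF l]
  obtain \<mu> where \<mu>: "functional sF \<mu>" "\<And>u. u \<in> U \<Longrightarrow> \<mu> u = \<phi> u"
    using dual_extends[OF gr \<phi>] by blast
  define c where "c i = l i e0" for i
  define l' where "l' i u = l i (\<iota> u) + c i * \<mu> u" for i u
  have l': "functional sF (l' i)" if "i < k" for i
    using that by (intro F.functionalI)
      (simp_all add: l'_def emb_arith l_arith F.functional_arith[OF \<mu>(1)] algebra_simps)
  have U_chart: "U \<in> grass_chart sF k l'"
    unfolding grass_chart_def
  proof (intro CollectI conjI ballI impI gr)
    fix u assume u: "u \<in> U" "\<forall>i<k. l' i u = 0"
    have "\<forall>i<k. l i (\<iota> u + sE (\<phi> u) e0) = 0"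
      using u \<mu>(2)[OF u(1)] by (simp add: l_arith l'_def c_def mult.commute)
    then have "\<iota> u + sE (\<phi> u) e0 = 0"
      using G graph_subspace(5)[OF sub \<phi> u(1)] by (auto simp: grass_chart_def)
    then have "\<pi> (\<iota> u + sE (\<phi> u) e0) = 0"
      using proj_arith(4) by simp
    then show "u = 0"
      by (simp add: proj_arith proj_emb proj_e0)
  qed
  let ?D = "Sigma (grass_chart sF k l' \<inter> isotropic_grass sF \<sigma> k) (dual_space sF)"
  let ?L = "dual_coords sF k l'"
  define u where "u y j = chart_frame k l' (fst y) j" for y :: "'f set \<times> ('f \<Rightarrow> complex)" and j
  define \<delta> where "\<delta> y j = snd y (u y j) - \<mu> (u y j)" for y j
  define q where "q y = 1 + (\<Sum>i<k. c i * \<delta> y i)" for y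
  define v where "v y j = \<iota> (u y j) + sE (snd y (u y j)) e0" for y j
  define w where "w y j = v y j - sE (\<delta> y j / q y) (\<Sum>i<k. sE (c i) (v y i))" for y j
  have \<delta>_poly: "(\<lambda>y. \<delta> y j) \<in> polys ?L" if "j < k" for j
    unfolding \<delta>_def u_def by (rule polys_diff[OF dual_coord_poly_fibre[OF that] dual_coord_poly_base[OF \<mu>(1) that]])
  have q_poly: "q \<in> polys ?L"
    unfolding q_def[abs_def] by (intro polys.add polys.const polys_sum polys_scale \<delta>_poly) auto
  have m_v: "m (v y j) = m (\<iota> (u y j)) + m e0 * snd y (u y j)" if "functional sE m" for m y j
    by (simp add: v_def E.functional_arith[OF that] mult.commute)
  have m_v_poly: "(\<lambda>y. m (v y j)) \<in> polys ?L" if "functional sE m" "j < k" for m j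
    unfolding m_v[OF that(1)] unfolding u_def
    by (rule polys.add[OF dual_coord_poly_base[OF functional_emb[OF that(1)] that(2)]
          polys_scale[OF dual_coord_poly_fibre[OF that(2)]]])
  have m_w: "m (w y j) = m (v y j) - \<delta> y j / q y * (\<Sum>i<k. c i * m (v y i))" if "functional sE m" for m y j
    using E.functional_sum_expand[OF that, of c "v y" "{..<k}"] by (simp add: w_def E.functional_arith[OF that])
  \<comment> \<open>The vectors \<open>w y j\<close> are given by the Sherman-Morrison formula; they are the frame of the graph.\<close>
  have frame: "graph (fst y) (snd y) \<in> grass_chart sE k l \<and>
      (\<forall>j<k. chart_frame k l (graph (fst y) (snd y)) j = w y j)" if y: "y \<in> ?D" "q y \<noteq> 0" for y
  proof -
    have W: "fst y \<in> grass_chart sF k l'" "fst y \<in> grass sF k" "F.subspace (fst y)"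
      and \<psi>: "snd y \<in> dual_space sF (fst y)"
      using y by (auto simp: isotropic_grass_def grass_def)
    note fr = F.chart_frame[OF W(1) l', folded u_def, simplified]
    note sub = graph_subspace[OF W(3) \<psi>]
    have v_mem: "v y j \<in> graph (fst y) (snd y)" if "j < k" for j
      unfolding v_def using sub(5) fr(1)[OF that] by simp
    have w_mem: "w y j \<in> graph (fst y) (snd y)" if "j < k" for j
      unfolding w_def using v_mem that
      by (intro E.subspace_diff E.subspace_scale E.subspace_sum sub(1)) auto
    have lv: "l i (v y j) = (if i = j then 1 else 0) + c i * \<delta> y j" if "i < k" "j < k" for i j
    proof -
      have "l i (v y j) = l' i (u y j) + c i * \<delta> y j"
        using m_v[OF l[OF that(1)]] by (simp add: l'_def c_def \<delta>_def algebra_simps)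
      then show ?thesis
        using fr(2)[of j i] that by simp
    qed
    have lw: "l i (w y j) = (if i = j then 1 else 0)" if "i < k" "j < k" for i j
    proof -
      have "(\<Sum>i'<k. c i' * l i (v y i')) = (\<Sum>i'<k. (if i = i' then c i' else 0) + c i * (c i' * \<delta> y i'))"
        using lv[OF that(1)] by (intro sum.cong) (auto simp: algebra_simps)
      also have "\<dots> = c i + c i * (\<Sum>i'<k. c i' * \<delta> y i')"
        using that by (simp add: sum.distrib sum_distrib_left)
      also have "\<dots> = c i * q y"
        by (simp add: q_def algebra_simps)
      finally show ?thesis
        using y(2) by (simp add: m_w[OF l[OF that(1)]] lv[OF that])
    qed
    have chart: "graph (fst y) (snd y) \<in> grass_chart sE k l"
      by (rule E.grass_chart_dualI[OF graph_grass[OF W(2) \<psi>] l w_mem lw])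
    then show ?thesis
      using E.chart_frameI[OF chart l w_mem lw] by auto
  qed
  have "(?D, ?L) \<in> dual_taut_variety sF \<sigma> k"
    using l' by (auto simp: dual_taut_variety_eq)
  moreover have "x \<in> ?D"
    using U U_chart \<phi> by (simp add: x)
  moreover have "q x \<noteq> 0"
  proof -
    have "\<delta> x i = 0" if "i < k" for i
      using \<mu>(2) F.chart_frame(1)[OF U_chart l' that] by (simp add: \<delta>_def u_def x)
    then show ?thesis
      by (simp add: q_def)
  qed
  moreover have "\<forall>y\<in>?D. q y \<noteq> 0 \<longrightarrow> (case y of (U, \<phi>) \<Rightarrow> graph U \<phi>) \<in> D'"
  proof (intro ballI impI)
    fix y assume y: "y \<in> ?D" "q y \<noteq> 0"
    then have "fst y \<in> isotropic_grass sF \<sigma> k" "snd y \<in> dual_space sF (fst y)" "F.subspace (fst y)"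
      by (auto simp: isotropic_grass_def grass_def)
    then show "(case y of (U, \<phi>) \<Rightarrow> graph U \<phi>) \<in> D'"
      using frame[OF y] graph_isotropic graph_subspace(2)
      by (simp add: eq off_kernel_def case_prod_beta')
  qed
  moreover have "\<forall>p\<in>L'. \<exists>r\<in>polys ?L. \<forall>y\<in>?D. q y \<noteq> 0 \<longrightarrow> p (case y of (U, \<phi>) \<Rightarrow> graph U \<phi>) = r y / q y"
  proof
    fix p assume "p \<in> L'"
    then obtain m j where m: "functional sE m" and j: "j < k" and p: "p = (\<lambda>V. m (chart_frame k l V j))"
      by (auto simp: eq frame_coords_def)
    \<comment> \<open>The coordinate of \<open>w y j\<close> with its denominator \<open>q y\<close> cleared.\<close>
    let ?r = "\<lambda>y. q y * m (v y j) - \<delta> y j * (\<Sum>i<k. c i * m (v y i))"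
    have "?r \<in> polys ?L"
      by (intro polys_diff polys.mult[OF q_poly] polys.mult[OF \<delta>_poly[OF j]] polys_sum polys_scale
          m_v_poly[OF m] j) auto
    moreover have "\<forall>y\<in>?D. q y \<noteq> 0 \<longrightarrow> p (case y of (U, \<phi>) \<Rightarrow> graph U \<phi>) = ?r y / q y"
    proof (intro ballI impI)
      fix y assume y: "y \<in> ?D" "q y \<noteq> 0"
      have "p (case y of (U, \<phi>) \<Rightarrow> graph U \<phi>) = m (w y j)"
        using frame[OF y] j by (simp add: p case_prod_beta')
      then show "p (case y of (U, \<phi>) \<Rightarrow> graph U \<phi>) = ?r y / q y"
        using y(2) by (simp add: m_w[OF m] diff_divide_distrib)
    qed
    ultimately show "\<exists>r\<in>polys ?L. \<forall>y\<in>?D. q y \<noteq> 0 \<longrightarrow> p (case y of (U, \<phi>) \<Rightarrow> graph U \<phi>) = r y / q y"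
      by - (rule rev_bexI)
  qed
  ultimately show "\<exists>D L q. (D, L) \<in> dual_taut_variety sF \<sigma> k \<and> x \<in> D \<and> q \<in> polys L \<and> q x \<noteq> 0 \<and>
      (\<forall>y\<in>D. q y \<noteq> 0 \<longrightarrow> (case y of (U, \<phi>) \<Rightarrow> graph U \<phi>) \<in> D') \<and>
      (\<forall>p\<in>L'. \<exists>r\<in>polys L. \<forall>y\<in>D. q y \<noteq> 0 \<longrightarrow> p (case y of (U, \<phi>) \<Rightarrow> graph U \<phi>) = r y / q y)"
    using q_poly by (intro exI conjI)
qed

lemma through_kernel_isomorphic:
  "variety_isomorphic (subvariety (isotropic_grass_variety sE \<omega> (Suc d)) (through_kernel (Suc d)))
     (isotropic_grass_variety sF \<sigma> d)"
  unfolding variety_isomorphic_def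
proof (intro exI conjI ballI)
  show "\<pi> -` (\<pi> ` V) = V"
    if "V \<in> topspace (zariski (subvariety (isotropic_grass_variety sE \<omega> (Suc d)) (through_kernel (Suc d))))" for V
    using that by (intro proj_vimage_image)
      (auto simp: E.topspace_isotropic_subvariety through_kernel_def isotropic_grass_def grass_def)
  show "\<pi> ` (\<pi> -` U) = U" for U
    by (rule surj_image_vimage_eq[OF proj_surj])
qed (rule proj_morphism vimage_morphism)+

lemma off_kernel_isomorphic:
  "variety_isomorphic (subvariety (isotropic_grass_variety sE \<omega> k) (off_kernel k))
     (dual_taut_variety sF \<sigma> k)"
  unfolding variety_isomorphic_def
proof (intro exI conjI ballI)
  show "(case (\<pi> ` V, slope V) of (U, \<phi>) \<Rightarrow> graph U \<phi>) = V"
    if "V \<in> topspace (zariski (subvariety (isotropic_grass_variety sE \<omega> k) (off_kernel k)))" for V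
    using that graph_slope[of V]
    by (auto simp: E.topspace_isotropic_subvariety off_kernel_def isotropic_grass_def grass_def)
  show "(\<pi> ` (case y of (U, \<phi>) \<Rightarrow> graph U \<phi>), slope (case y of (U, \<phi>) \<Rightarrow> graph U \<phi>)) = y"
    if y: "y \<in> topspace (zariski (dual_taut_variety sF \<sigma> k))" for y
  proof -
    obtain U \<phi> where "y = (U, \<phi>)" "F.subspace U" "\<phi> \<in> dual_space sF U"
      using y by (auto simp: F.topspace_dual_taut_variety isotropic_grass_def grass_def)
    then show ?thesis
      using graph_subspace(3,4)[of U \<phi>] by simp
  qed
qed (rule graph_proj_morphism graph_morphism)+

end

section \<open>The group action and its orbits\<close>

context skew_space
begin

lemma Sp_carrier_iff:
  "g \<in> carrier (Sp s \<omega>) \<longleftrightarrow> Vector_Spaces.linear s s g \<and> bij g \<and> (\<forall>x y. \<omega> (g x) (g y) = \<omega> x y)"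
  by (simp add: Sp_def GL_def)

lemma Sp_mult: "mult (Sp s \<omega>) = (\<circ>)" and Sp_one: "one (Sp s \<omega>) = id"
  by (simp_all add: Sp_def GL_def)

lemma Sp_inv:
  assumes "g \<in> carrier (Sp s \<omega>)"
  shows "inv_into UNIV g \<in> carrier (Sp s \<omega>)"
proof -
  have g: "Vector_Spaces.linear s s g" "bij g" "\<And>x y. \<omega> (g x) (g y) = \<omega> x y"
    using assms by (auto simp: Sp_carrier_iff)
  have gi: "g (inv_into UNIV g y) = y" for y
    using g(2) by (simp add: bij_is_surj surj_f_inv_f)
  have "Vector_Spaces.linear s s (inv_into UNIV g)"
    unfolding Vector_Spaces.linear_iff
  proof (intro conjI allI vector_space_axioms)
    have "g (x + y) = g x + g y" "g (s c x) = s c (g x)" for x y c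
      using g(1) by (simp_all add: Vector_Spaces.linear_iff)
    then show "inv_into UNIV g (x + y) = inv_into UNIV g x + inv_into UNIV g y"
      "inv_into UNIV g (s c x) = s c (inv_into UNIV g x)" for x y c
      using g(2) by (metis bij_inv_eq_iff)+
  qed
  moreover have "\<omega> (inv_into UNIV g x) (inv_into UNIV g y) = \<omega> x y" for x y
    using g(3)[of "inv_into UNIV g x" "inv_into UNIV g y"] by (simp add: gi)
  ultimately show ?thesis
    using bij_imp_bij_inv[OF g(2)] by (simp add: Sp_carrier_iff)
qed

lemma group_Sp: "Group.group (Sp s \<omega>)"
proof (rule groupI)
  show "x \<otimes>\<^bsub>Sp s \<omega>\<^esub> y \<in> carrier (Sp s \<omega>)" if "x \<in> carrier (Sp s \<omega>)" "y \<in> carrier (Sp s \<omega>)" for x y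
    using that Vector_Spaces.linear_compose[of s s y s x] by (auto simp: Sp_carrier_iff Sp_mult bij_comp)
  show "\<one>\<^bsub>Sp s \<omega>\<^esub> \<in> carrier (Sp s \<omega>)"
    using vector_space_axioms by (simp add: Sp_carrier_iff Sp_one Vector_Spaces.linear_iff)
  show "\<exists>y\<in>carrier (Sp s \<omega>). y \<otimes>\<^bsub>Sp s \<omega>\<^esub> x = \<one>\<^bsub>Sp s \<omega>\<^esub>" if x: "x \<in> carrier (Sp s \<omega>)" for x
  proof (rule bexI[OF _ Sp_inv[OF x]])
    show "inv_into UNIV x \<otimes>\<^bsub>Sp s \<omega>\<^esub> x = \<one>\<^bsub>Sp s \<omega>\<^esub>"
      using x by (simp add: Sp_mult Sp_one Sp_carrier_iff bij_is_inj)
  qed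
qed (simp_all add: Sp_mult Sp_one comp_assoc)

lemma Sp_image_isotropic:
  assumes g: "g \<in> carrier (Sp s \<omega>)" and V: "V \<in> isotropic_grass s \<omega> k"
  shows "g ` V \<in> isotropic_grass s \<omega> k"
proof -
  have g': "Vector_Spaces.linear s s g" "bij g" "\<And>x y. \<omega> (g x) (g y) = \<omega> x y"
    using g by (auto simp: Sp_carrier_iff)
  have V': "subspace V" "dim V = k"
    using V by (auto simp: isotropic_grass_def grass_def)
  interpret p: finite_dimensional_vector_space_pair_1 s Basis s
    by unfold_locales
  have "dim (g ` V) = dim V"
    using p.dim_image_eq[OF g'(1)] bij_is_inj[OF g'(2)] by (metis inj_on_subset subset_UNIV)
  moreover have "subspace (g ` V)"
    using module_hom.subspace_image[OF linear_iff_module_hom[THEN iffD1, OF g'(1)] V'(1)] .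
  ultimately show ?thesis
    using V V' g'(3) by (auto simp: isotropic_grass_def grass_def)
qed

lemma Sp_action: "group_action (Sp s \<omega>) (isotropic_grass s \<omega> k) (subspace_action s \<omega> k)"
proof -
  let ?X = "isotropic_grass s \<omega> k" and ?a = "subspace_action s \<omega> k"
  have comp: "?a (g \<circ> h) = compose ?X (?a g) (?a h)" if "h \<in> carrier (Sp s \<omega>)" for g h
    using Sp_image_isotropic[OF that]
    by (auto simp: subspace_action_def compose_def fun_eq_iff image_comp)
  have Bij: "?a g \<in> Bij ?X" if g: "g \<in> carrier (Sp s \<omega>)" for g
  proof -
    have inv: "inv_into UNIV g ` g ` V = V" "g ` inv_into UNIV g ` V = V" for V
      using g by (auto simp: Sp_carrier_iff image_inv_f_f image_f_inv_f bij_is_inj bij_is_surj)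
    have "bij_betw (?a g) ?X ?X"
    proof (rule bij_betw_byWitness[where f' = "?a (inv_into UNIV g)"])
      show "\<forall>V\<in>?X. ?a (inv_into UNIV g) (?a g V) = V" "\<forall>V\<in>?X. ?a g (?a (inv_into UNIV g) V) = V"
        using Sp_image_isotropic[OF g] Sp_image_isotropic[OF Sp_inv[OF g]] inv
        by (simp_all add: subspace_action_def)
      show "?a g ` ?X \<subseteq> ?X" "?a (inv_into UNIV g) ` ?X \<subseteq> ?X"
        using Sp_image_isotropic[OF g] Sp_image_isotropic[OF Sp_inv[OF g]]
        by (auto simp: subspace_action_def)
    qed
    then show ?thesis
      by (simp add: Bij_def subspace_action_def)
  qed
  have "?a \<in> hom (Sp s \<omega>) (BijGroup ?X)"
    using Bij comp by (auto simp: hom_def BijGroup_def Sp_mult)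
  then show ?thesis
    using group_Sp group_BijGroup by (intro group_action.intro group_hom.intro group_hom_axioms.intro)
qed

end

context odd_splitting
begin

lemma form_kernel_proj: "x \<in> form_kernel \<omega> \<longleftrightarrow> \<pi> x = 0"
proof
  assume "x \<in> form_kernel \<omega>"
  then have "\<sigma> (\<pi> x) u = 0" for u
    using form_proj[of x "\<iota> u"] by (simp add: form_kernel_def proj_emb)
  then have "\<pi> x \<in> form_kernel \<sigma>"
    by (simp add: form_kernel_def)
  then show "\<pi> x = 0"
    by (simp add: nondegenerate)
qed (simp add: form_kernel_def form_proj F.form_arith)

text \<open>
  The preimage of \<open>e0\<close> under \<open>g\<close> is again orthogonal to everything, so it is a multiple of \<open>e0\<close>.
\<close>

lemma Sp_fixes_kernel:
  assumes g: "g \<in> carrier (Sp sE \<omega>)" and V: "E.subspace V" "e0 \<in> V"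
  shows "e0 \<in> g ` V"
proof -
  have gi: "g (inv_into UNIV g y) = y" for y
    using g by (simp add: E.Sp_carrier_iff bij_is_surj surj_f_inv_f)
  let ?x = "inv_into UNIV g e0"
  have "\<omega> ?x y = 0" for y
  proof -
    have "\<omega> ?x y = \<omega> (g ?x) (g y)"
      using g unfolding E.Sp_carrier_iff by metis
    then show ?thesis
      by (simp add: gi form_proj proj_e0 F.form_arith)
  qed
  then have "\<pi> ?x = 0"
    by (simp add: form_kernel_proj[symmetric] form_kernel_def)
  then have "?x = sE (\<eta> ?x) e0"
    by (simp add: proj_eq_0_iff)
  then have "?x \<in> V"
    using E.subspace_scale[OF V] by metis
  then show ?thesis
    using gi by (metis imageI)
qed

lemma Sp_kernel_iff:
  assumes g: "g \<in> carrier (Sp sE \<omega>)" and V: "V \<in> isotropic_grass sE \<omega> k"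
  shows "e0 \<in> g ` V \<longleftrightarrow> e0 \<in> V"
proof
  assume e0: "e0 \<in> g ` V"
  have "E.subspace (g ` V)"
    using E.Sp_image_isotropic[OF g V] by (simp add: isotropic_grass_def grass_def)
  from Sp_fixes_kernel[OF E.Sp_inv[OF g] this e0] show "e0 \<in> V"
    using g by (simp add: E.Sp_carrier_iff image_inv_f_f bij_is_inj)
next
  assume "e0 \<in> V"
  then show "e0 \<in> g ` V"
    using Sp_fixes_kernel[OF g] V by (simp add: isotropic_grass_def grass_def)
qed

text \<open>
  \<open>h\<close> acts on the \<open>F\<close>-component, and \<open>\<mu>\<close> shears along the kernel line, which the form does not notice.
\<close>

definition lift :: "('f \<Rightarrow> 'f) \<Rightarrow> ('f \<Rightarrow> complex) \<Rightarrow> 'e \<Rightarrow> 'e" where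
  "lift h \<mu> x = \<iota> (h (\<pi> x)) + sE (\<eta> x + \<mu> (\<pi> x)) e0"

lemma lift_components: "\<pi> (lift h \<mu> x) = h (\<pi> x)" "\<eta> (lift h \<mu> x) = \<eta> x + \<mu> (\<pi> x)"
  by (simp_all add: lift_def proj_arith proj_emb proj_e0 height_arith height_emb height_e0)

lemma lift_Sp:
  assumes h: "Vector_Spaces.linear sF sF h" and hh': "\<And>u. h' (h u) = u" "\<And>u. h (h' u) = u"
    and iso: "\<And>u v. \<sigma> (h u) (h v) = \<sigma> u v" and \<mu>: "functional sF \<mu>"
  shows "lift h \<mu> \<in> carrier (Sp sE \<omega>)"
  unfolding E.Sp_carrier_iff
proof (intro conjI allI)
  have "h (u + v) = h u + h v" "h (sF c u) = sF c (h u)" for u v c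
    using h by (simp_all add: Vector_Spaces.linear_iff)
  then show "Vector_Spaces.linear sE sE (lift h \<mu>)"
    using E.vector_space_axioms
    by (simp add: Vector_Spaces.linear_iff eq_iff_proj_height lift_components proj_arith height_arith
        F.functional_arith[OF \<mu>] distrib_left)
  have "lift h' (\<lambda>u. - \<mu> (h' u)) (lift h \<mu> x) = x" "lift h \<mu> (lift h' (\<lambda>u. - \<mu> (h' u)) x) = x" for x
    by (simp_all add: eq_iff_proj_height lift_components hh')
  then show "bij (lift h \<mu>)"
    by (intro o_bij[of "lift h' (\<lambda>u. - \<mu> (h' u))"]) (simp_all add: fun_eq_iff)
  show "\<omega> (lift h \<mu> x) (lift h \<mu> y) = \<omega> x y" for x y
    by (simp add: form_proj lift_components iso)
qed

lemma Sp_image_eqI: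
  assumes g: "g \<in> carrier (Sp sE \<omega>)" and "V \<in> isotropic_grass sE \<omega> k" "V' \<in> isotropic_grass sE \<omega> k"
    and "g ` V \<subseteq> V'"
  shows "g ` V = V'"
  using E.Sp_image_isotropic[OF g assms(2)] assms(3,4)
  by (intro E.subspace_dim_equal) (auto simp: isotropic_grass_def grass_def)

lemma through_kernel_transitive:
  assumes "V \<in> through_kernel (Suc d)" "V' \<in> through_kernel (Suc d)"
  shows "\<exists>g\<in>carrier (Sp sE \<omega>). g ` V = V'"
proof -
  have V: "V \<in> isotropic_grass sE \<omega> (Suc d)" "e0 \<in> V" and V': "V' \<in> isotropic_grass sE \<omega> (Suc d)" "e0 \<in> V'"
    using assms by (auto simp: through_kernel_def)
  obtain h h' where h: "Vector_Spaces.linear sF sF h" "\<forall>u. h' (h u) = u" "\<forall>u. h (h' u) = u"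
    "\<forall>u v. \<sigma> (h u) (h v) = \<sigma> u v" "h ` \<pi> ` V \<subseteq> \<pi> ` V'"
    using F.witt_isometry[OF nondegenerate proj_isotropic_through_kernel[OF V] proj_isotropic_through_kernel[OF V']]
    by (elim exE conjE)
  have g: "lift h (\<lambda>_. 0) \<in> carrier (Sp sE \<omega>)"
    by (rule lift_Sp[OF h(1) h(2-4)[rule_format]]) (auto intro: F.functionalI)
  have "lift h (\<lambda>_. 0) ` V \<subseteq> \<pi> -` (\<pi> ` V')"
    using subsetD[OF h(5)] by (force simp: lift_components)
  then have "lift h (\<lambda>_. 0) ` V \<subseteq> V'"
    using proj_vimage_image[of V'] V' by (simp add: isotropic_grass_def grass_def)
  then show ?thesis
    using Sp_image_eqI[OF g V(1) V'(1)] g by blast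
qed

text \<open>
  The lift of an isometry \<open>h\<close> sends the graph of a functional over \<open>\<pi> ` V\<close> to a graph over \<open>\<pi> ` V'\<close>. The
  shear by the difference \<open>\<mu>2 \<circ> h - \<mu>1\<close> of extensions of the two slopes turns it into \<open>V'\<close>.
\<close>

lemma off_kernel_transitive:
  assumes "V \<in> off_kernel k" "V' \<in> off_kernel k"
  shows "\<exists>g\<in>carrier (Sp sE \<omega>). g ` V = V'"
proof -
  have V: "V \<in> isotropic_grass sE \<omega> k" "e0 \<notin> V" and V': "V' \<in> isotropic_grass sE \<omega> k" "e0 \<notin> V'"
    using assms by (auto simp: off_kernel_def)
  then have sub: "E.subspace V" "E.subspace V'"
    by (auto simp: isotropic_grass_def grass_def)
  obtain h h' where h: "Vector_Spaces.linear sF sF h" "\<forall>u. h' (h u) = u" "\<forall>u. h (h' u) = u"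
    "\<forall>u v. \<sigma> (h u) (h v) = \<sigma> u v" "h ` \<pi> ` V \<subseteq> \<pi> ` V'"
    using F.witt_isometry[OF nondegenerate proj_isotropic_off_kernel[OF V] proj_isotropic_off_kernel[OF V']]
    by (elim exE conjE)
  have gr: "\<pi> ` V \<in> grass sF k" "\<pi> ` V' \<in> grass sF k"
    using proj_isotropic_off_kernel[OF V] proj_isotropic_off_kernel[OF V'] by (auto simp: isotropic_grass_def)
  obtain \<mu>1 where \<mu>1: "functional sF \<mu>1" "\<And>u. u \<in> \<pi> ` V \<Longrightarrow> \<mu>1 u = slope V u"
    using dual_extends[OF gr(1) slope_dual[OF sub(1) V(2)]] by blast
  obtain \<mu>2 where \<mu>2: "functional sF \<mu>2" "\<And>u. u \<in> \<pi> ` V' \<Longrightarrow> \<mu>2 u = slope V' u"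
    using dual_extends[OF gr(2) slope_dual[OF sub(2) V'(2)]] by blast
  define \<mu> where "\<mu> u = \<mu>2 (h u) - \<mu>1 u" for u
  have "functional sF \<mu>"
    using F.functional_arith[OF \<mu>1(1)] F.functional_arith[OF functional_compose[OF h(1) \<mu>2(1)]]
    by (intro F.functionalI) (simp_all add: \<mu>_def algebra_simps)
  then have g: "lift h \<mu> \<in> carrier (Sp sE \<omega>)"
    by (rule lift_Sp[OF h(1) h(2-4)[rule_format]])
  have "lift h \<mu> x \<in> graph (\<pi> ` V') (slope V')" if x: "x \<in> V" for x
  proof -
    have "h (\<pi> x) \<in> \<pi> ` V'"
      using h(5) x by blast
    then show ?thesis
      using x \<mu>1(2)[of "\<pi> x"] \<mu>2(2) slope_proj[OF sub(1) V(2) x]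
      by (simp add: graph_def lift_components \<mu>_def)
  qed
  then have "lift h \<mu> ` V \<subseteq> V'"
    using graph_slope[OF sub(2) V'(2)] by auto
  then show ?thesis
    using Sp_image_eqI[OF g V(1) V'(1)] g by blast
qed

lemma orbit_eq:
  assumes V: "V \<in> isotropic_grass sE \<omega> k"
  shows "orbit (Sp sE \<omega>) (subspace_action sE \<omega> k) V = {g ` V | g. g \<in> carrier (Sp sE \<omega>)}"
  using V by (auto simp: orbit_def subspace_action_def)

lemma orbit_through_kernel:
  assumes "V \<in> through_kernel (Suc d)"
  shows "orbit (Sp sE \<omega>) (subspace_action sE \<omega> (Suc d)) V = through_kernel (Suc d)"
proof -
  have V: "V \<in> isotropic_grass sE \<omega> (Suc d)" "e0 \<in> V"
    using assms by (auto simp: through_kernel_def)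
  show ?thesis
    unfolding orbit_eq[OF V(1)]
    using through_kernel_transitive[OF assms] E.Sp_image_isotropic[OF _ V(1)] Sp_kernel_iff[OF _ V(1)] V(2)
    by (fastforce simp: through_kernel_def)
qed

lemma orbit_off_kernel:
  assumes "V \<in> off_kernel k"
  shows "orbit (Sp sE \<omega>) (subspace_action sE \<omega> k) V = off_kernel k"
proof -
  have V: "V \<in> isotropic_grass sE \<omega> k" "e0 \<notin> V"
    using assms by (auto simp: off_kernel_def)
  show ?thesis
    unfolding orbit_eq[OF V(1)]
    using off_kernel_transitive[OF assms] E.Sp_image_isotropic[OF _ V(1)] Sp_kernel_iff[OF _ V(1)] V(2)
    by (fastforce simp: off_kernel_def)
qed

lemma strata_nonempty:
  assumes "2 * Suc d \<le> F.dim UNIV"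
  shows "through_kernel (Suc d) \<noteq> {}" "off_kernel (Suc d) \<noteq> {}"
proof -
  obtain U where "U \<in> isotropic_grass sF \<sigma> d"
    using F.isotropic_exists[OF nondegenerate, of d] assms by auto
  then have "\<pi> -` U \<in> through_kernel (Suc d)"
    using vimage_isotropic by (simp add: through_kernel_def)
  then show "through_kernel (Suc d) \<noteq> {}"
    by blast
  obtain U where U: "U \<in> isotropic_grass sF \<sigma> (Suc d)"
    using F.isotropic_exists[OF nondegenerate, of "Suc d"] assms by auto
  then have sub: "F.subspace U"
    by (simp add: isotropic_grass_def grass_def)
  then have "(\<lambda>u\<in>U. 0) \<in> dual_space sF U"
    by (auto simp: dual_space_def F.subspace_def)
  then have "graph U (\<lambda>u\<in>U. 0) \<in> off_kernel (Suc d)"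
    using graph_isotropic[OF U] graph_subspace(2)[OF sub] by (simp add: off_kernel_def)
  then show "off_kernel (Suc d) \<noteq> {}"
    by blast
qed

lemma orbits_isotropic_grass:
  assumes "2 * Suc d \<le> F.dim UNIV"
  shows "orbits (Sp sE \<omega>) (isotropic_grass sE \<omega> (Suc d)) (subspace_action sE \<omega> (Suc d))
    = {through_kernel (Suc d), off_kernel (Suc d)}"
proof -
  let ?o = "orbit (Sp sE \<omega>) (subspace_action sE \<omega> (Suc d))"
  have "orbits (Sp sE \<omega>) (isotropic_grass sE \<omega> (Suc d)) (subspace_action sE \<omega> (Suc d))
      = ?o ` through_kernel (Suc d) \<union> ?o ` off_kernel (Suc d)"
    unfolding orbits_def through_kernel_def off_kernel_def by auto
  also have "?o ` through_kernel (Suc d) = {through_kernel (Suc d)}"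
    using strata_nonempty(1)[OF assms] by (auto simp: orbit_through_kernel)
  also have "?o ` off_kernel (Suc d) = {off_kernel (Suc d)}"
    using strata_nonempty(2)[OF assms] by (auto simp: orbit_off_kernel)
  finally show ?thesis
    by auto
qed

end

section \<open>The odd symplectic Grassmannian\<close>

text \<open>
  The dimension of a space without a finite basis is \<open>0\<close> by convention.
\<close>

lemma finite_dimensional_of_dim:
  assumes "vector_space s" "vector_space.dim s UNIV > 0"
  shows "\<exists>B. finite_dimensional_vector_space s B"
proof -
  interpret vector_space s by fact
  obtain B where B: "independent B" "UNIV \<subseteq> span B" "card B = dim UNIV"
    by (rule basis_exists)
  have "finite_dimensional_vector_space s B"
  proof unfold_locales
    show "finite B"
      using assms(2) by (intro card_ge_0_finite) (simp only: B(3))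
    show "span B = UNIV"
      using B(2) by (rule top.extremum_uniqueI)
  qed (rule B(1))
  then show ?thesis
    by blast
qed

lemma skew_space_exists:
  assumes "vector_space s" "vector_space.dim s UNIV > 0" "skew_form s \<omega>"
  shows "\<exists>B. skew_space s B \<omega>"
  using finite_dimensional_of_dim[OF assms(1,2)] assms(3)
  unfolding skew_space_def skew_space_axioms_def complex_space_def by blast

theorem proposition4p3:
  fixes n k :: nat
    and sE :: "complex \<Rightarrow> 'e::ab_group_add \<Rightarrow> 'e" and \<omega> :: "'e \<Rightarrow> 'e \<Rightarrow> complex" and e0 :: 'e
    and sF :: "complex \<Rightarrow> 'f::ab_group_add \<Rightarrow> 'f" and \<sigma> :: "'f \<Rightarrow> 'f \<Rightarrow> complex"
    and X0 X1 :: "'e set set"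
  assumes "odd_symplectic_space n sE \<omega>"
    and "form_kernel \<omega> = module.span sE {e0}"
    and "symplectic_space n sF \<sigma>"
    and "1 \<le> k" and "k \<le> n"
    and "X0 = {V \<in> isotropic_grass sE \<omega> k. e0 \<in> V}"
    and "X1 = {V \<in> isotropic_grass sE \<omega> k. e0 \<notin> V}"
  shows "group_action (Sp sE \<omega>) (isotropic_grass sE \<omega> k) (subspace_action sE \<omega> k) \<and>
    orbits (Sp sE \<omega>) (isotropic_grass sE \<omega> k) (subspace_action sE \<omega> k) = {X0, X1} \<and> X0 \<noteq> X1 \<and>
    closedin (zariski (isotropic_grass_variety sE \<omega> k)) X0 \<and>
    variety_isomorphic (subvariety (isotropic_grass_variety sE \<omega> k) X0)
      (isotropic_grass_variety sF \<sigma> (k - 1)) \<and>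
    openin (zariski (isotropic_grass_variety sE \<omega> k)) X1 \<and>
    variety_isomorphic (subvariety (isotropic_grass_variety sE \<omega> k) X1)
      (dual_taut_variety sF \<sigma> k)"
proof -
  obtain BE BF where E: "skew_space sE BE \<omega>" and F: "skew_space sF BF \<sigma>"
    using skew_space_exists[of sE \<omega>] skew_space_exists[of sF \<sigma>] assms(1,3-5)
    unfolding odd_symplectic_space_def symplectic_space_def by auto
  obtain \<pi> \<iota> \<eta> where "odd_splitting sE BE \<omega> sF BF \<sigma> e0 \<pi> \<iota> \<eta>"
    using odd_splitting_exists[OF E F, of n e0] assms(1-3)
    unfolding odd_symplectic_space_def symplectic_space_def by blast
  then interpret odd_splitting sE BE \<omega> sF BF \<sigma> e0 \<pi> \<iota> \<eta> .
  obtain d where k: "k = Suc d"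
    using assms(4) by (cases k) auto
  have dim: "2 * Suc d \<le> F.dim UNIV"
    using assms(3,5) by (simp add: symplectic_space_def k)
  have X: "X0 = through_kernel (Suc d)" "X1 = off_kernel (Suc d)"
    by (simp_all add: assms(6,7) k through_kernel_def off_kernel_def)
  have "X0 \<noteq> X1"
    using strata_nonempty(1)[OF dim] by (auto simp: X through_kernel_def off_kernel_def)
  then show ?thesis
    unfolding k X diff_Suc_1
    by (intro conjI E.Sp_action orbits_isotropic_grass[OF dim] closedin_through_kernel
        openin_off_kernel through_kernel_isomorphic off_kernel_isomorphic)
qed

end
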